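(* Suppose that for every $\theta$ in a neighborhood of $\theta_0$, $$P_0(m_\theta-m_{\theta_0})\lesssim-\lVert\theta-\theta_0\rVert^2,$$ and that for every $N$ and sufficiently small $\delta>0$, $$E^*\sup_{\lVert\theta-\theta_0\rVert<\delta}\left|\mathbb G_N(m_\theta-m_{\theta_0})\right|\lesssim\phi_N(\delta)$$ for functions $\phi_N$ such that $\delta\mapsto\phi_N(\delta)/\delta^\alpha$ is decreasing for some $\alpha<2$ (not depending on $N$). If $\hat\theta_N\to_{P^*}\theta_0$ and $\mathbb P_N^{\mathrm H}m_{\hat\theta_N}\ge\mathbb P_N^{\mathrm H}m_{\theta_0}-O_{P^*}(r_N^{-2})$, then $r_N\lVert\hat\theta_N-\theta_0\rVert=O_{P^*}(1)$ for every $r_N$ such that $r_N^2\phi_N(1/r_N)\le\sqrt N$ for every $N$.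
   Context: Setting. $X$ takes values in a measurable space $(\mathcal{X},\mathcal{A})$ and has law $P_0=P_{\theta_0}$, a member of a collection of probability measures $\{P_\theta:\theta\in\Theta\}$ on $(\mathcal X,\mathcal A)$, where $\Theta$ is a subset of a Banach space $(\mathcal B,\lVert\cdot\rVert)$ and $\theta_0\in\Theta$. $\{m_\theta:\theta\in\Theta\}$ are criterion functions $\mathcal X\to\mathbb R$, and $\hat\theta_N$ is a $\Theta$-valued estimator. $U\in\mathcal U$ is a vector of auxiliary variables, $W=(X,U)$ has law $\tilde P_0$, and $V=(\check X,U)\in\mathcal V$, where $\check X$ is a coarsening (measurable function) of $X$. $\mathcal V=\bigcup_{j=1}^J\mathcal V^{(j)}$ is a union of $J$ measurable, possibly overlapping data sources. $Qf=\int f\,dQ$. Sampling. $W_1,\dots,W_N$ are i.i.d. copies of $W$ with corresponding $X_i,V_i$; $N^{(j)}=\#\{i\le N:V_i\in\mathcal V^{(j)}\}$. From each source $j$ a simple random sample of size $n^{(j)}\le N^{(j)}$ ($n^{(j)}$ random, through $N^{(j)}$) is drawn without replacement from the units with $V_i\in\mathcal V^{(j)}$, independently across sources given the data; $R_i^{(j)}$ is the selection indicator ($0$ if $V_i\notin\mathcal V^{(j)}$); $\pi^{(j)}(V_i)=(n^{(j)}/N^{(j)})I\{V_i\in\mathcal V^{(j)}\}$, with $\pi^{(j)}(v)\to p^{(j)}I\{v\in\mathcal V^{(j)}\}$, $p^{(j)}\ge c>0$, as $N\to\infty$; convention $0/0=0$. Weight function. $\rho=(\rho^{(1)},\dots,\rho^{(J)}):\mathcal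 V\to[0,1]^J$ is fixed, constant on each of the disjoint regions of $\mathcal V$ determined by which of the sources contain $v$, with $\rho^{(j)}(v)=0$ if $v\notin\mathcal V^{(j)}$, $\rho^{(j)}(v)=1$ if $v$ belongs to $\mathcal V^{(j)}$ only, and $\sum_{j}\rho^{(j)}(v)=1$. H-empirical measure. $\mathbb P_N^{\mathrm H}f=\frac1N\sum_{i=1}^N\sum_{j=1}^J\frac{R_i^{(j)}\rho^{(j)}(V_i)}{\pi^{(j)}(V_i)}f(X_i)$. Ordinary empirical process: $\mathbb G_Nf=\sqrt N\big(\frac1N\sum_{i=1}^Nf(X_i)-P_0f\big)$. $a\lesssim b$ means $a\le Kb$ for some constant $K\in(0,\infty)$. $P^*,E^*$ are outer probability and outer expectation for the joint law of data and sampling indicators; $\to_{P^*}$, $O_{P^*}$ are taken with respect to $P^*$. *)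

theory Defs
  imports "HOL-Probability.Probability"
begin

section \<open>Outer expectation and stochastic order symbols\<close>

text \<open>
  Outer probability is \<^const>\<open>outer_measure_of\<close>. Outer expectations are only needed for
  nonnegative maps. The integral \<^const>\<open>nn_integral\<close> of a non-measurable map is a lower
  integral, so the infimum over measurable majorants has to be spelled out.
\<close>

definition outer_expectation :: "'w measure \<Rightarrow> ('w \<Rightarrow> ennreal) \<Rightarrow> ennreal" where
  "outer_expectation M T =
     (INF Z \<in> {Z \<in> borel_measurable M. \<forall>\<omega>\<in>space M. T \<omega> \<le> Z \<omega>}. \<integral>\<^sup>+ \<omega>. Z \<omega> \<partial>M)"

text \<open>
  The maps in a sequence are defined on the probability spaces \<open>M N\<close>, which change with \<open>N\<close>,
  and need not be measurable.
\<close>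

definition tendsto_outer_prob ::
    "(nat \<Rightarrow> 'w measure) \<Rightarrow> (nat \<Rightarrow> 'w \<Rightarrow> 'b::metric_space) \<Rightarrow> 'b \<Rightarrow> bool" where
  "tendsto_outer_prob M Z z \<longleftrightarrow>
     (\<forall>\<epsilon>>0. (\<lambda>N. outer_measure_of (M N) {\<omega> \<in> space (M N). dist (Z N \<omega>) z > \<epsilon>}) \<longlonglongrightarrow> 0)"

definition bounded_outer_prob ::
    "(nat \<Rightarrow> 'w measure) \<Rightarrow> (nat \<Rightarrow> 'w \<Rightarrow> real) \<Rightarrow> bool" where
  "bounded_outer_prob M Z \<longleftrightarrow>
     (\<forall>\<epsilon>>0. \<exists>K. \<forall>\<^sub>F N in sequentially.
        outer_measure_of (M N) {\<omega> \<in> space (M N). \<bar>Z N \<omega>\<bar> > K} \<le> ennreal \<epsilon>)"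


section \<open>Merged data from overlapping sources\<close>

text \<open>
  A unit is a pair \<open>(x, u)\<close>; \<open>h\<close> is the coarsening map. The data sources are
  \<open>\<V> :: 'j \<Rightarrow> ('c \<times> 'u) set\<close>, indexed by a finite type \<open>'j\<close> with \<open>J = CARD('j)\<close> elements.
\<close>

definition vval :: "('x \<Rightarrow> 'c) \<Rightarrow> 'x \<times> 'u \<Rightarrow> 'c \<times> 'u" where
  "vval h w = (h (fst w), snd w)"

definition source_units ::
    "('x \<Rightarrow> 'c) \<Rightarrow> ('j \<Rightarrow> ('c \<times> 'u) set) \<Rightarrow> nat \<Rightarrow> (nat \<Rightarrow> 'x \<times> 'u) \<Rightarrow> 'j \<Rightarrow> nat set" where
  "source_units h \<V> N w j = {i. i < N \<and> vval h (w i) \<in> \<V> j}"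

text \<open>
  \<open>n N j k\<close> is the size of the sample from source \<open>j\<close> when \<open>k\<close> of the \<open>N\<close> units belong to it;
  the sample size is random through \<open>k\<close>.
\<close>

definition sample_size ::
    "('x \<Rightarrow> 'c) \<Rightarrow> ('j \<Rightarrow> ('c \<times> 'u) set) \<Rightarrow> (nat \<Rightarrow> 'j \<Rightarrow> nat \<Rightarrow> nat) \<Rightarrow>
     nat \<Rightarrow> (nat \<Rightarrow> 'x \<times> 'u) \<Rightarrow> 'j \<Rightarrow> nat" where
  "sample_size h \<V> n N w j = n N j (card (source_units h \<V> N w j))"

text \<open>
  Conditional law, given the data \<open>w\<close>, of the family of selected samples \<open>S j \<subseteq> {..<N}\<close>:
  simple random sampling without replacement in each source, independently across sources.
\<close>

definition selection_pmf ::
    "('x \<Rightarrow> 'c) \<Rightarrow> ('j::finite \<Rightarrow> ('c \<times> 'u) set) \<Rightarrow> (nat \<Rightarrow> 'j \<Rightarrow> nat \<Rightarrow> nat) \<Rightarrow>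
     nat \<Rightarrow> (nat \<Rightarrow> 'x \<times> 'u) \<Rightarrow> ('j \<Rightarrow> nat set) pmf" where
  "selection_pmf h \<V> n N w =
     Pi_pmf UNIV {}
       (\<lambda>j. pmf_of_set {A. A \<subseteq> source_units h \<V> N w j \<and> card A = sample_size h \<V> n N w j})"

text \<open>
  Joint law of the data \<open>W\<^sub>0, \<dots>, W\<^sub>N\<^sub>-\<^sub>1\<close> (i.i.d. with law \<open>Q\<close>) and the selected samples. The
  samples range over a finite set, so the conditional law enters as a density with respect
  to counting measure.
\<close>

definition joint_law ::
    "('x \<times> 'u) measure \<Rightarrow> ('x \<Rightarrow> 'c) \<Rightarrow> ('j::finite \<Rightarrow> ('c \<times> 'u) set) \<Rightarrow>
     (nat \<Rightarrow> 'j \<Rightarrow> nat \<Rightarrow> nat) \<Rightarrow> nat \<Rightarrow> ((nat \<Rightarrow> 'x \<times> 'u) \<times> ('j \<Rightarrow> nat set)) measure" where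
  "joint_law Q h \<V> n N =
     density (PiM {..<N} (\<lambda>_. Q) \<Otimes>\<^sub>M count_space {S. \<forall>j. S j \<subseteq> {..<N}})
       (\<lambda>(w, S). ennreal (pmf (selection_pmf h \<V> n N w) S))"

definition sel_prob ::
    "('x \<Rightarrow> 'c) \<Rightarrow> ('j \<Rightarrow> ('c \<times> 'u) set) \<Rightarrow> (nat \<Rightarrow> 'j \<Rightarrow> nat \<Rightarrow> nat) \<Rightarrow>
     nat \<Rightarrow> (nat \<Rightarrow> 'x \<times> 'u) \<Rightarrow> 'j \<Rightarrow> 'c \<times> 'u \<Rightarrow> real" where
  "sel_prob h \<V> n N w j v =
     real (sample_size h \<V> n N w j) / real (card (source_units h \<V> N w j)) * indicator (\<V> j) v"

definition weight_function ::
    "('j::finite \<Rightarrow> 'v set) \<Rightarrow> ('j \<Rightarrow> 'v \<Rightarrow> real) \<Rightarrow> bool" where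
  "weight_function \<V> \<rho> \<longleftrightarrow>
     (\<forall>v \<in> (\<Union>j. \<V> j).
        (\<forall>j. 0 \<le> \<rho> j v \<and> \<rho> j v \<le> 1) \<and>
        (\<forall>j. v \<notin> \<V> j \<longrightarrow> \<rho> j v = 0) \<and>
        (\<forall>j. v \<in> \<V> j \<and> (\<forall>k. k \<noteq> j \<longrightarrow> v \<notin> \<V> k) \<longrightarrow> \<rho> j v = 1) \<and>
        (\<Sum>j\<in>UNIV. \<rho> j v) = 1) \<and>
     (\<forall>v \<in> (\<Union>j. \<V> j). \<forall>v' \<in> (\<Union>j. \<V> j).
        (\<forall>k. v \<in> \<V> k \<longleftrightarrow> v' \<in> \<V> k) \<longrightarrow> (\<forall>j. \<rho> j v = \<rho> j v'))"

text \<open>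
  The selection indicator of unit \<open>i\<close> in source \<open>j\<close> is \<open>of_bool (i \<in> S j)\<close>.
  Division by zero gives zero, in accordance with the convention \<open>0/0 = 0\<close>.
\<close>

definition H_emp ::
    "('x \<Rightarrow> 'c) \<Rightarrow> ('j::finite \<Rightarrow> ('c \<times> 'u) set) \<Rightarrow> (nat \<Rightarrow> 'j \<Rightarrow> nat \<Rightarrow> nat) \<Rightarrow>
     ('j \<Rightarrow> 'c \<times> 'u \<Rightarrow> real) \<Rightarrow> nat \<Rightarrow> (nat \<Rightarrow> 'x \<times> 'u) \<times> ('j \<Rightarrow> nat set) \<Rightarrow>
     ('x \<Rightarrow> real) \<Rightarrow> real" where
  "H_emp h \<V> n \<rho> N = (\<lambda>(w, S) f.
     1 / real N * (\<Sum>i<N. \<Sum>j\<in>UNIV.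
       of_bool (i \<in> S j) * \<rho> j (vval h (w i)) / sel_prob h \<V> n N w j (vval h (w i)) * f (fst (w i))))"

definition emp_process ::
    "'x measure \<Rightarrow> nat \<Rightarrow> (nat \<Rightarrow> 'x \<times> 'u) \<Rightarrow> ('x \<Rightarrow> real) \<Rightarrow> real" where
  "emp_process P0 N w f =
     sqrt (real N) * (1 / real N * (\<Sum>i<N. f (fst (w i))) - (\<integral>x. f x \<partial>P0))"

text \<open>The density in \<^const>\<open>joint_law\<close> is measurable, and the joint law has total mass one.\<close>

lemma measurable_selection_pmf:
  fixes \<V> :: "'j::finite \<Rightarrow> ('c \<times> 'u) set"
  assumes Q: "sets Q = sets (MX \<Otimes>\<^sub>M MU)" and h: "h \<in> measurable MX MC"
    and \<V>: "\<And>j. \<V> j \<in> sets (MC \<Otimes>\<^sub>M MU)"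
  shows "(\<lambda>(w, S). ennreal (pmf (selection_pmf h \<V> n N w) S)) \<in> borel_measurable
     (PiM {..<N} (\<lambda>_. Q) \<Otimes>\<^sub>M count_space {S. \<forall>j. S j \<subseteq> {..<N}})"
proof -
  let ?A = "{S. \<forall>j. S j \<subseteq> {..<N}} :: ('j \<Rightarrow> nat set) set"
  have "?A = PiE UNIV (\<lambda>_. Pow {..<N})" by auto
  then have fin: "finite ?A" by (simp add: finite_PiE)
  have vv: "vval h \<in> measurable Q (MC \<Otimes>\<^sub>M MU)"
    unfolding vval_def measurable_cong_sets[OF Q refl] using h by measurable
  have meas: "{w \<in> space (PiM {..<N} (\<lambda>_. Q)). vval h (w i) \<in> \<V> j} \<in> sets (PiM {..<N} (\<lambda>_. Q))"
    if "i < N" for i j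
  proof -
    have "(\<lambda>w. vval h (w i)) \<in> measurable (PiM {..<N} (\<lambda>_. Q)) (MC \<Otimes>\<^sub>M MU)"
      by (rule measurable_compose[OF _ vv], rule measurable_component_singleton) (use that in auto)
    from measurable_sets[OF this \<V>[of j]] show ?thesis by (simp add: vimage_def Int_def conj_commute)
  qed
  have units: "source_units h \<V> N \<in> measurable (PiM {..<N} (\<lambda>_. Q)) (count_space ?A)"
  proof (subst measurable_count_space_eq2[OF fin], intro conjI ballI)
    show "source_units h \<V> N \<in> space (PiM {..<N} (\<lambda>_. Q)) \<rightarrow> ?A"
      by (auto simp: source_units_def)
    fix S :: "'j \<Rightarrow> nat set" assume S: "S \<in> ?A"
    have "source_units h \<V> N -` {S} \<inter> space (PiM {..<N} (\<lambda>_. Q)) =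
       {w \<in> space (PiM {..<N} (\<lambda>_. Q)). \<forall>j\<in>UNIV. \<forall>i\<in>{..<N}. vval h (w i) \<in> \<V> j \<longleftrightarrow> i \<in> S j}"
      using S by (fastforce simp: source_units_def fun_eq_iff set_eq_iff)
    also have "\<dots> \<in> sets (PiM {..<N} (\<lambda>_. Q))"
    proof (intro sets.sets_Collect_finite_All finite)
      fix j i assume "i \<in> {..<N}"
      then have "i < N" by simp
      show "{w \<in> space (PiM {..<N} (\<lambda>_. Q)). vval h (w i) \<in> \<V> j \<longleftrightarrow> i \<in> S j} \<in> sets (PiM {..<N} (\<lambda>_. Q))"
        by (cases "i \<in> S j") (auto intro: meas[OF \<open>i < N\<close>] sets.sets_Collect_neg)
    qed auto
    finally show "source_units h \<V> N -` {S} \<inter> space (PiM {..<N} (\<lambda>_. Q)) \<in> sets (PiM {..<N} (\<lambda>_. Q))" .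
  qed
  define G where "G = (\<lambda>T::'j \<Rightarrow> nat set. Pi_pmf UNIV {} (\<lambda>j. pmf_of_set {A. A \<subseteq> T j \<and> card A = n N j (card (T j))}))"
  have G: "selection_pmf h \<V> n N w = G (source_units h \<V> N w)" for w
    by (simp add: G_def selection_pmf_def sample_size_def)
  have "(\<lambda>z. ennreal (pmf (selection_pmf h \<V> n N (fst z)) (snd z))) \<in> borel_measurable
     (PiM {..<N} (\<lambda>_. Q) \<Otimes>\<^sub>M count_space ?A)"
  proof (rule measurable_compose_countable'[where I = ?A and g = snd])
    show "countable ?A" using fin by (rule countable_finite)
    show "snd \<in> measurable (PiM {..<N} (\<lambda>_. Q) \<Otimes>\<^sub>M count_space ?A) (count_space ?A)" by simp
    fix S assume "S \<in> ?A"
    have "(\<lambda>z. source_units h \<V> N (fst z)) \<in> measurable (PiM {..<N} (\<lambda>_. Q) \<Otimes>\<^sub>M count_space ?A) (count_space ?A)"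
      by (rule measurable_compose[OF measurable_fst units])
    then show "(\<lambda>z. ennreal (pmf (selection_pmf h \<V> n N (fst z)) S)) \<in> borel_measurable
     (PiM {..<N} (\<lambda>_. Q) \<Otimes>\<^sub>M count_space ?A)"
      unfolding G by (rule measurable_compose) simp
  qed
  then show ?thesis by (simp add: case_prod_beta')
qed

lemma prob_space_joint_law:
  fixes \<V> :: "'j::finite \<Rightarrow> ('c \<times> 'u) set"
  assumes "prob_space Q" and Q: "sets Q = sets (MX \<Otimes>\<^sub>M MU)" and h: "h \<in> measurable MX MC"
    and \<V>: "\<And>j. \<V> j \<in> sets (MC \<Otimes>\<^sub>M MU)" and n: "\<And>j k. k \<le> N \<Longrightarrow> n N j k \<le> k"
  shows "prob_space (joint_law Q h \<V> n N)"
proof -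
  let ?A = "{S. \<forall>j. S j \<subseteq> {..<N}} :: ('j \<Rightarrow> nat set) set"
  let ?P = "PiM {..<N} (\<lambda>_. Q)"
  have "?A = PiE UNIV (\<lambda>_. Pow {..<N})" by auto
  then have fin: "finite ?A" by (simp add: finite_PiE)
  interpret Q: prob_space Q by fact
  interpret product_prob_space "\<lambda>_. Q" "{..<N}" ..
  interpret P: prob_space ?P by (intro prob_space_PiM assms(1))
  interpret C: sigma_finite_measure "count_space ?A"
    by (rule sigma_finite_measure_count_space_finite[OF fin])
  have one: "(\<integral>\<^sup>+ S. ennreal (pmf (selection_pmf h \<V> n N w) S) \<partial>count_space ?A) = 1" for w
  proof -
    have sub: "set_pmf (selection_pmf h \<V> n N w) \<subseteq> ?A"
    proof -
      have ne: "{A. A \<subseteq> source_units h \<V> N w j \<and> card A = sample_size h \<V> n N w j} \<noteq> {}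
          \<and> finite {A. A \<subseteq> source_units h \<V> N w j \<and> card A = sample_size h \<V> n N w j}" for j
      proof -
        have u: "source_units h \<V> N w j \<subseteq> {..<N}" by (auto simp: source_units_def)
        then have f: "finite (source_units h \<V> N w j)" by (rule finite_subset) simp
        have "card (source_units h \<V> N w j) \<le> N" using card_mono[OF _ u] by simp
        then have "sample_size h \<V> n N w j \<le> card (source_units h \<V> N w j)"
          by (simp add: sample_size_def n)
        then show ?thesis using obtain_subset_with_card_n[of _ "source_units h \<V> N w j"] f by fastforce
      qed
      show ?thesis
        unfolding selection_pmf_def using ne
        by (auto simp: set_Pi_pmf PiE_dflt_def set_pmf_of_set source_units_def dest: subsetD)
    qed
    have "(\<integral>\<^sup>+ S. ennreal (pmf (selection_pmf h \<V> n N w) S) \<partial>count_space ?A)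
        = emeasure (measure_pmf (selection_pmf h \<V> n N w)) ?A"
      by (rule nn_integral_pmf)
    also have "\<dots> = 1"
      using sub by (intro measure_pmf.emeasure_eq_1_AE) (auto simp: AE_measure_pmf_iff)
    finally show ?thesis .
  qed
  show ?thesis
  proof
    have "emeasure (joint_law Q h \<V> n N) (space (joint_law Q h \<V> n N)) =
       (\<integral>\<^sup>+ (w, S). ennreal (pmf (selection_pmf h \<V> n N w) S) \<partial>(?P \<Otimes>\<^sub>M count_space ?A))"
      unfolding joint_law_def
      by (subst emeasure_density[OF measurable_selection_pmf[OF Q h \<V>]])
        (auto intro!: nn_integral_cong simp: space_pair_measure)
    also have "\<dots> = (\<integral>\<^sup>+ w. (\<integral>\<^sup>+ S. ennreal (pmf (selection_pmf h \<V> n N w) S) \<partial>count_space ?A) \<partial>?P)"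
      using C.nn_integral_fst[OF measurable_selection_pmf[OF Q h \<V>, where N = N and n = n]] by simp
    also have "\<dots> = 1" by (simp add: one P.emeasure_space_1)
    finally show "emeasure (joint_law Q h \<V> n N) (space (joint_law Q h \<V> n N)) = 1" .
  qed
qed

end

(*
  Write f = m_theta - m_theta0, Y_i = f(X_i) - P_0 f and W_i for the H-weight of unit i. Then
  P^H f = (P_0 f) (1/N) sum W_i + (1/N) sum W_i Y_i. The first average is at least 1/2 with
  high probability, so the curvature survives, and it remains to bound sup_f |sum W_i Y_i| in mean
  by a multiple of sup_f |sum Y_i|; the rate then follows by peeling over dyadic shells.

  Up to the factor 1/pi, W_i - 1 is a sum over the sources of (R_i - pi) rho_i. For given data the
  centered indicators of a simple random sample are the conditional mean, up to a factor of at
  least 1/4, of independent Rademacher signs that can be taken uniform on all units, independently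
  of the data. By Jensen's inequality this replaces the sampling weights by signs, and a signed sum
  is a difference of two partial sums over fixed index sets, each of which is dominated by the full
  sum since the Y_i are centered. All majorants are explicit finite combinations of measurable maps,
  because outer expectations do not iterate.
*)
theory Submission
  imports Defs
begin

section \<open>Simple random samples and Rademacher signs\<close>

text \<open>Whether a unit lies in a source, and the \<open>\<rho>\<close> attached to it, are
  functions of the same observation that enters Y_i. Conditioning on the memberships would destroy
  the centering of Y_i, and signs on the units of one source only would leave a random index set.
  This is why the signs are extended to all units: averaged over the sample, the coefficient of each
  sign pattern \<open>B\<close> is at most 4 / 2^N, whatever the memberships and
  \<open>\<rho>\<close> are. So \<open>B\<close> can be held fixed while the data are integrated,
  and Jensen's inequality applies to \<open>B\<close> and to its complement. The 4 is the reciprocal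
  of the lower bound on \<open>chain_gain\<close>. The weights need not add up to N, so P^H does not
  reproduce constants. The total weight is controlled by the same coupling, with the constant 1 in
  place of Y_i. In the peeling the drift on shell s grows like 4^s and the mean of the supremum like
  2^(\<alpha> s); \<alpha> < 2 makes the shell probabilities summable.\<close>

definition sg :: "'a set \<Rightarrow> 'a \<Rightarrow> real" where
  "sg B i = (if i \<in> B then 1 else -1)"

text \<open>A sign vector is encoded by the set of its plus signs, so a sum over
  \<open>Pow A\<close> is \<open>2 ^ card A\<close> times a Rademacher expectation. By independence
  and mean zero of the signs only the constants \<open>u i\<close> survive; in the proof this is the
  distributive law with (u + v) + (u - v) = 2 u.\<close>

lemma sum_Pow_prod_sg:
  fixes u v :: "'a \<Rightarrow> real"
  assumes "finite A"
  shows "(\<Sum>B\<in>Pow A. \<Prod>i\<in>A. u i + v i * sg B i) = 2 ^ card A * (\<Prod>i\<in>A. u i)"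
proof -
  have "(\<Sum>B\<in>Pow A. \<Prod>i\<in>A. u i + v i * sg B i)
      = (\<Sum>B\<in>Pow A. (\<Prod>i\<in>B. u i + v i) * (\<Prod>i\<in>A - B. u i - v i))"
  proof (rule sum.cong[OF refl])
    fix B assume "B \<in> Pow A"
    then have B: "B \<subseteq> A" by simp
    show "(\<Prod>i\<in>A. u i + v i * sg B i) = (\<Prod>i\<in>B. u i + v i) * (\<Prod>i\<in>A - B. u i - v i)"
      by (subst prod.subset_diff[OF B assms], subst mult.commute,
          intro arg_cong2[where f = "(*)"] prod.cong) (auto simp: sg_def)
  qed
  also have "\<dots> = (\<Prod>i\<in>A. (u i + v i) + (u i - v i))"
    using assms by (rule prod_add[symmetric])
  also have "\<dots> = 2 ^ card A * (\<Prod>i\<in>A. u i)"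
    by (simp add: prod.distrib)
  finally show ?thesis .
qed

lemma sum_Pow_riesz:
  fixes a :: "'a \<Rightarrow> real"
  assumes "finite A"
  shows "(\<Sum>B\<in>Pow A. \<Prod>i\<in>A. 1 + a i * sg B i) = 2 ^ card A"
  using sum_Pow_prod_sg[OF assms, of "\<lambda>_. 1" a] by simp

text \<open>For \<bar>a i\<bar> \<le> 1 the Riesz product is a probability density with respect to
  uniform signs, under which the sign of \<open>l\<close> has mean \<open>a l\<close>. Since a sign
  squares to 1, the extra factor \<open>sg B l\<close> just exchanges the two coefficients of factor
  \<open>l\<close>.\<close>

lemma sum_Pow_riesz_sg:
  fixes a :: "'a \<Rightarrow> real"
  assumes A: "finite A" and l: "l \<in> A"
  shows "(\<Sum>B\<in>Pow A. (\<Prod>i\<in>A. 1 + a i * sg B i) * sg B l) = 2 ^ card A * a l"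
proof -
  have "(\<Prod>i\<in>A. 1 + a i * sg B i) * sg B l
      = (\<Prod>i\<in>A. (if i = l then a l else 1) + (if i = l then 1 else a i) * sg B i)" for B
    using A l by (simp add: prod.remove[OF A l] sg_def algebra_simps)
  then show ?thesis
    using sum_Pow_prod_sg[OF A, of "\<lambda>i. if i = l then a l else 1" "\<lambda>i. if i = l then 1 else a i"]
      A l by (simp add: prod.delta)
qed

lemma sum_Pow_sg_square:
  assumes "finite A"
  shows "(\<Sum>B\<in>Pow A. (\<Sum>i\<in>A. sg B i)\<^sup>2) = real (card A) * 2 ^ card A"
  using assms
proof (induction A)
  case (insert a A)
  have inj: "inj_on (insert a) (Pow A)"
    using insert by (intro inj_onI) (auto dest!: Pow_iff[THEN iffD1])
  have "(\<Sum>B\<in>Pow (insert a A). (\<Sum>i\<in>insert a A. sg B i)\<^sup>2)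
      = (\<Sum>B\<in>Pow A. (\<Sum>i\<in>insert a A. sg B i)\<^sup>2) + (\<Sum>B\<in>Pow A. (\<Sum>i\<in>insert a A. sg (insert a B) i)\<^sup>2)"
    unfolding Pow_insert using insert
    by (subst sum.union_disjoint) (auto simp: sum.reindex[OF inj])
  also have "\<dots> = (\<Sum>B\<in>Pow A. (- 1 + (\<Sum>i\<in>A. sg B i))\<^sup>2) + (\<Sum>B\<in>Pow A. (1 + (\<Sum>i\<in>A. sg B i))\<^sup>2)"
  proof (intro arg_cong2[where f = "(+)"] sum.cong refl arg_cong[where f = "\<lambda>x. x\<^sup>2"])
    fix B assume "B \<in> Pow A"
    then show "(\<Sum>i\<in>insert a A. sg B i) = - 1 + (\<Sum>i\<in>A. sg B i)"
      using insert by (subst sum.insert) (auto simp: sg_def)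
    have "(\<Sum>i\<in>A. sg (insert a B) i) = (\<Sum>i\<in>A. sg B i)"
      using insert by (intro sum.cong) (auto simp: sg_def)
    then show "(\<Sum>i\<in>insert a A. sg (insert a B) i) = 1 + (\<Sum>i\<in>A. sg B i)"
      using insert by (subst sum.insert) (auto simp: sg_def)
  qed
  also have "\<dots> = (\<Sum>B\<in>Pow A. 2 + 2 * (\<Sum>i\<in>A. sg B i)\<^sup>2)"
    unfolding sum.distrib[symmetric] by (intro sum.cong) (auto simp: power2_eq_square algebra_simps)
  also have "\<dots> = real (card (insert a A)) * 2 ^ card (insert a A)"
    using insert by (simp add: sum.distrib sum_distrib_left[symmetric] card_Pow algebra_simps)
  finally show ?case .
qed simp

text \<open>Cauchy-Schwarz and the variance of a Rademacher sum. This serves the total weight, where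
  the summands are the constant 1 and no centering of the data is available.\<close>

lemma sum_Pow_abs_sum_sg_le:
  assumes "finite A"
  shows "(\<Sum>B\<in>Pow A. \<bar>\<Sum>i\<in>A. sg B i\<bar>) \<le> sqrt (card A) * 2 ^ card A"
proof -
  let ?x = "\<lambda>B. \<Sum>i\<in>A. sg B i"
  have "(\<Sum>B\<in>Pow A. \<bar>?x B\<bar>)\<^sup>2 \<le> (\<Sum>B\<in>Pow A. (?x B)\<^sup>2) * (\<Sum>B\<in>Pow A. 1)"
    using Cauchy_Schwarz_ineq_sum[of "\<lambda>B. \<bar>?x B\<bar>" "\<lambda>_. 1" "Pow A"] by simp
  also have "\<dots> = (sqrt (card A) * 2 ^ card A)\<^sup>2"
    using assms by (simp add: sum_Pow_sg_square card_Pow power_mult_distrib) (simp add: power2_eq_square)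
  finally show ?thesis
    by (rule power2_le_imp_le) simp
qed

text \<open>A uniform \<open>k\<close>-subset of \<open>S\<close> contains a point \<open>i\<close>
  of \<open>S\<close> with probability \<open>k / card S\<close>, and its sign has mean twice that
  minus 1. For \<open>k > card S\<close> both sides are 0.\<close>

lemma sum_subsets_sg:
  assumes S: "finite S" "S \<noteq> {}"
  shows "(\<Sum>B | B \<subseteq> S \<and> card B = k. sg B i)
      = real (card S choose k) * (2 * (real k / real (card S)) * of_bool (i \<in> S) - 1)"
proof -
  let ?F = "{B. B \<subseteq> S \<and> card B = k}"
  have fin: "finite ?F" using S by simp
  have cF: "card ?F = card S choose k" using S by (simp add: n_subsets)
  show ?thesis
  proof (cases "i \<in> S")
    case False
    then have "(\<Sum>B\<in>?F. sg B i) = (\<Sum>B\<in>?F. - 1)" by (intro sum.cong) (auto simp: sg_def)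
    then show ?thesis using False cF by simp
  next
    case True
    have eq: "?F \<inter> {B. i \<notin> B} = {B. B \<subseteq> S - {i} \<and> card B = k}" by auto
    have c: "card (?F \<inter> {B. i \<notin> B}) = (card S - 1) choose k"
      unfolding eq using S True by (subst n_subsets) auto
    have "(\<Sum>B\<in>?F. sg B i) = (\<Sum>B\<in>?F. 1 - 2 * of_bool (i \<notin> B))"
      by (intro sum.cong) (auto simp: sg_def)
    also have "\<dots> = real (card S choose k) - 2 * real ((card S - 1) choose k)"
      using fin cF c by (simp add: sum_subtractf sum_distrib_left[symmetric])
    finally have 1: "(\<Sum>B\<in>?F. sg B i) = real (card S choose k) - 2 * real ((card S - 1) choose k)" .
    have "real ((card S - k) * (card S choose k)) = real (card S * ((card S - 1) choose k))"
      by (simp only: binomial_absorb_comp)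
    then have "(real (card S) - real k) * real (card S choose k) = real (card S) * real ((card S - 1) choose k)"
      by (cases "k \<le> card S") (auto simp: of_nat_diff binomial_eq_0)
    moreover have "card S > 0" using S by (simp add: card_gt_0_iff)
    ultimately have "real ((card S - 1) choose k) = (1 - real k / real (card S)) * real (card S choose k)"
      by (simp add: field_simps)
    then show ?thesis unfolding 1 using True by (simp only: algebra_simps) simp
  qed
qed

text \<open>Joint law, up to normalization, of a uniform subset \<open>B\<close> of \<open>T\<close> and a subset \<open>S\<close> of size \<open>n\<close>
  drawn uniformly from those comparable with \<open>B\<close>. By symmetry \<open>S\<close> is a simple random sample, and the
  conditional mean of the Rademacher signs of \<open>B\<close> given \<open>S\<close> is proportional to the centered
  selection indicators.\<close>

definition chain_kernel :: "nat \<Rightarrow> 'a set \<Rightarrow> 'a set \<Rightarrow> 'a set \<Rightarrow> real" where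
  "chain_kernel n T S B =
     (if card B \<le> n then of_bool (B \<subseteq> S) / real ((card T - card B) choose (n - card B))
      else of_bool (S \<subseteq> B) / real (card B choose n))"

lemma chain_kernel_nonneg: "0 \<le> chain_kernel n T S B"
  by (simp add: chain_kernel_def)

lemma bij_betw_union_subsets:
  fixes k :: nat
  assumes "finite T" "A \<subseteq> T" "card A \<le> k"
  shows "bij_betw (\<lambda>C. A \<union> C) {C. C \<subseteq> T - A \<and> card C = k - card A}
     {B. B \<subseteq> T \<and> card B = k \<and> A \<subseteq> B}"
proof (rule bij_betwI[where g = "\<lambda>B. B - A"])
  have fA: "finite A" using assms finite_subset by blast
  show "(\<lambda>C. A \<union> C) \<in> {C. C \<subseteq> T - A \<and> card C = k - card A} \<rightarrow> {B. B \<subseteq> T \<and> card B = k \<and> A \<subseteq> B}"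
  proof safe
    fix C assume C: "C \<subseteq> T - A" "card C = k - card A"
    have "card (A \<union> C) = card A + card C"
      using C fA assms by (intro card_Un_disjoint) (auto intro: finite_subset)
    then show "card (A \<union> C) = k" using C assms by simp
  qed (use assms in auto)
  show "(\<lambda>B. B - A) \<in> {B. B \<subseteq> T \<and> card B = k \<and> A \<subseteq> B} \<rightarrow> {C. C \<subseteq> T - A \<and> card C = k - card A}"
    using fA by (auto simp: card_Diff_subset)
qed auto

text \<open>For fixed \<open>B\<close> the kernel is a conditional law of \<open>S\<close>: its
  denominators count the \<open>n\<close>-subsets of \<open>T\<close> that contain \<open>B\<close>,
  or that lie in \<open>B\<close>.\<close>

lemma sum_chain_kernel:
  assumes T: "finite T" and B: "B \<subseteq> T" and n: "n \<le> card T"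
  shows "(\<Sum>S | S \<subseteq> T \<and> card S = n. chain_kernel n T S B) = 1"
proof -
  let ?F = "{S. S \<subseteq> T \<and> card S = n}"
  have fB: "finite B" using assms finite_subset by blast
  have fF: "finite ?F" using T by simp
  have cB: "card B \<le> card T" using B T card_mono by blast
  show ?thesis
  proof (cases "card B \<le> n")
    case True
    have "card {S. S \<subseteq> T \<and> card S = n \<and> B \<subseteq> S} = card {C. C \<subseteq> T - B \<and> card C = n - card B}"
      using bij_betw_same_card[OF bij_betw_union_subsets[OF T B True]] by simp
    also have "\<dots> = (card T - card B) choose (n - card B)"
      using T B fB by (subst n_subsets) (auto simp: card_Diff_subset)
    finally have c: "card (?F \<inter> {S. B \<subseteq> S}) = (card T - card B) choose (n - card B)"
      by (simp add: Int_def conj_assoc)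
    have "(card T - card B) choose (n - card B) > 0"
      using n True by (simp add: zero_less_binomial_iff)
    then show ?thesis
      using True c fF by (simp add: chain_kernel_def sum_divide_distrib[symmetric])
  next
    case False
    have "card (?F \<inter> {S. S \<subseteq> B}) = card {S. S \<subseteq> B \<and> card S = n}"
      using B by (intro arg_cong[where f = card]) auto
    also have "\<dots> = card B choose n" using fB by (simp add: n_subsets)
    finally have c: "card (?F \<inter> {S. S \<subseteq> B}) = card B choose n" .
    have "card B choose n > 0" using False by (simp add: zero_less_binomial_iff)
    then show ?thesis
      using False c fF by (simp add: chain_kernel_def sum_divide_distrib[symmetric])
  qed
qed

text \<open>Slope of an inclusion probability: given \<open>S\<close> of size n in a set of size t,
  a uniform comparable \<open>B\<close> of size k contains \<open>i\<close> with probability k/t +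
  \<open>chain_factor t n k\<close> * (1{i in S} - n/t).\<close>

definition chain_factor :: "nat \<Rightarrow> nat \<Rightarrow> nat \<Rightarrow> real" where
  "chain_factor t n k = (if k \<le> n then real k / real n else (real t - real k) / (real t - real n))"

text \<open>Given \<open>S\<close>, a comparable \<open>B\<close> of size \<open>k\<close> is a
  uniform subset of \<open>S\<close> when \<open>k \<le> n\<close>, and \<open>S\<close> plus a
  uniform subset of \<open>T - S\<close> of size \<open>k - n\<close> otherwise. In both cases the
  inclusion probability of \<open>i\<close> takes one value on \<open>S\<close> and one off
  \<open>S\<close>, hence is affine in the centered indicator.\<close>

lemma sum_chain_kernel_sg_level:
  assumes T: "finite T" and S: "S \<subseteq> T" "card S = n" and n: "0 < n" "n < card T"
    and i: "i \<in> T" and k: "k \<le> card T"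
  shows "(\<Sum>B | B \<subseteq> T \<and> card B = k. chain_kernel n T S B * sg B i)
    = real (card T choose k) / real (card T choose n) *
      (2 * (real k / real (card T) + chain_factor (card T) n k * (of_bool (i \<in> S) - real n / real (card T))) - 1)"
proof -
  let ?t = "card T"
  have fS: "finite S" using S T finite_subset by blast
  have pos: "real (?t choose n) > 0" "real (?t choose k) > 0" using n k by (simp_all add: zero_less_binomial_iff)
  have t0: "?t > 0" using n by simp
  show ?thesis
  proof (cases "k \<le> n")
    case True
    have "(\<Sum>B | B \<subseteq> T \<and> card B = k. chain_kernel n T S B * sg B i)
        = (\<Sum>B | B \<subseteq> S \<and> card B = k. sg B i / real ((?t - k) choose (n - k)))"
      using S T True by (intro sum.mono_neutral_cong_right) (auto simp: chain_kernel_def)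
    also have "\<dots> = real (n choose k) / real ((?t - k) choose (n - k)) *
        (2 * (real k / real n) * of_bool (i \<in> S) - 1)"
      using fS S n by (subst sum_divide_distrib[symmetric], subst sum_subsets_sg) auto
    \<comment> \<open>Nested pairs of sizes \<open>k\<close> and \<open>n\<close> are counted from
      either end. The total weight of a level is therefore the same for every
      \<open>S\<close>.\<close>
    also have "real (n choose k) / real ((?t - k) choose (n - k)) = real (?t choose k) / real (?t choose n)"
    proof -
      have "(?t choose n) * (n choose k) = (?t choose k) * ((?t - k) choose (n - k))"
        using True n by (intro choose_mult) auto
      then have "real (?t choose n) * real (n choose k) = real (?t choose k) * real ((?t - k) choose (n - k))"
        by (metis of_nat_mult)
      moreover have "real ((?t - k) choose (n - k)) > 0"
        using True n by (simp add: zero_less_binomial_iff)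
      ultimately show ?thesis using pos by (simp add: field_simps)
    qed
    also have "2 * (real k / real n) * of_bool (i \<in> S) - 1 = 2 * (real k / real ?t + chain_factor ?t n k * (of_bool (i \<in> S) - real n / real ?t)) - 1"
      using True n t0 by (simp add: chain_factor_def field_simps)
    finally show ?thesis .
  next
    case False
    let ?G = "{C. C \<subseteq> T - S \<and> card C = k - n}"
    have cTS: "card (T - S) = ?t - n" using S fS by (simp add: card_Diff_subset)
    have neTS: "T - S \<noteq> {}" using cTS n by (metis card.empty zero_less_diff less_irrefl)
    have bij: "bij_betw (\<lambda>C. S \<union> C) ?G {B. B \<subseteq> T \<and> card B = k \<and> S \<subseteq> B}"
      using bij_betw_union_subsets[OF T S(1), of k] S False by simp
    have "(\<Sum>B | B \<subseteq> T \<and> card B = k. chain_kernel n T S B * sg B i)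
        = (\<Sum>B | B \<subseteq> T \<and> card B = k \<and> S \<subseteq> B. sg B i / real (k choose n))"
      using T False by (intro sum.mono_neutral_cong_right) (auto simp: chain_kernel_def)
    also have "\<dots> = (\<Sum>C\<in>?G. sg (S \<union> C) i) / real (k choose n)"
      by (subst sum.reindex_bij_betw[OF bij, symmetric]) (simp add: sum_divide_distrib)
    also have "(\<Sum>C\<in>?G. sg (S \<union> C) i) = real ((?t - n) choose (k - n)) *
        (if i \<in> S then 1 else 2 * (real (k - n) / real (?t - n)) - 1)"
    proof (cases "i \<in> S")
      case True
      then have "(\<Sum>C\<in>?G. sg (S \<union> C) i) = real (card ?G)" by (simp add: sg_def)
      also have "card ?G = (?t - n) choose (k - n)" using T cTS by (subst n_subsets) auto
      finally show ?thesis using True by simp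
    next
      case False
      then have "(\<Sum>C\<in>?G. sg (S \<union> C) i) = (\<Sum>C\<in>?G. sg C i)" by (simp add: sg_def)
      also have "\<dots> = real ((?t - n) choose (k - n)) * (2 * (real (k - n) / real (?t - n)) - 1)"
        using sum_subsets_sg[where S = "T - S" and k = "k - n" and i = i] T cTS neTS i False by simp
      finally show ?thesis using False by simp
    qed
    also have "\<dots> / real (k choose n) = real ((?t - n) choose (k - n)) / real (k choose n) *
        (if i \<in> S then 1 else 2 * (real (k - n) / real (?t - n)) - 1)" by simp
    also have "real ((?t - n) choose (k - n)) / real (k choose n) = real (?t choose k) / real (?t choose n)"
    proof -
      have "(?t choose k) * (k choose n) = (?t choose n) * ((?t - n) choose (k - n))"
        using False k by (intro choose_mult) auto
      then have "real (?t choose k) * real (k choose n) = real (?t choose n) * real ((?t - n) choose (k - n))"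
        by (metis of_nat_mult)
      moreover have "real (k choose n) > 0"
        using False by (simp add: zero_less_binomial_iff)
      ultimately show ?thesis using pos by (simp add: field_simps)
    qed
    also have "(if i \<in> S then 1 else 2 * (real (k - n) / real (?t - n)) - 1)
       = 2 * (real k / real ?t + chain_factor ?t n k * (of_bool (i \<in> S) - real n / real ?t)) - 1"
    proof -
      define a b where "a = real ?t - real n" and "b = real ?t"
      have ab: "a > 0" "b > 0" using n by (auto simp: a_def b_def)
      have n': "real n = b - a" "real (?t - n) = a" "real (k - n) = real k - (b - a)"
        using n False by (auto simp: a_def b_def of_nat_diff)
      show ?thesis
        unfolding n' chain_factor_def b_def[symmetric] using False ab
        by (simp add: field_simps)
    qed
    finally show ?thesis .
  qed
qed

text \<open>Twice the mean of \<open>chain_factor\<close> at a Binomial(t, 1/2) size, the size of a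
  uniform random subset.\<close>

definition chain_gain :: "nat \<Rightarrow> nat \<Rightarrow> real" where
  "chain_gain t n = 2 * (\<Sum>k\<le>t. real (t choose k) * chain_factor t n k) / 2 ^ t"

lemma sum_choose_real: "(\<Sum>k\<le>t. real (t choose k)) = 2 ^ t"
  using choose_row_sum[of t] by (metis of_nat_numeral of_nat_power of_nat_sum)

lemma sum_choose_linear_real: "(\<Sum>k\<le>t. real k * real (t choose k)) = real t * 2 ^ (t - 1)"
proof -
  have "real (\<Sum>k\<le>t. k * (t choose k)) = real (t * 2 ^ (t - 1))"
    by (simp only: choose_linear_sum)
  then show ?thesis by simp
qed

text \<open>Both branches of \<open>chain_factor\<close> dominate x (1 - x) with x = k/t. For a
  Binomial(t, 1/2) size this has mean (t - 1) / (4 t), which is at least 1/8 because 0 < n < t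
  forces t \<ge> 2; doubling gives 1/4.\<close>

lemma chain_gain_ge:
  assumes n: "0 < n" "n < t"
  shows "1/4 \<le> chain_gain t n"
proof -
  have t: "2 \<le> t" using n by simp
  have le: "real k * (real t - real k) / (real t)\<^sup>2 \<le> chain_factor t n k" if "k \<le> t" for k
  proof (cases "k \<le> n")
    case True
    have "real k * (real t - real k) / (real t)\<^sup>2 = (real k / real t) * ((real t - real k) / real t)"
      by (simp add: power2_eq_square)
    also have "\<dots> \<le> real k / real t * 1"
      using that t by (intro mult_left_mono) auto
    also have "\<dots> \<le> real k / real n"
      using n by (simp add: frac_le)
    finally show ?thesis using True by (simp add: chain_factor_def)
  next
    case False
    have "real k * (real t - real k) / (real t)\<^sup>2 = (real k / real t) * ((real t - real k) / real t)"
      by (simp add: power2_eq_square)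
    also have "\<dots> \<le> 1 * ((real t - real k) / real t)"
      using that t by (intro mult_right_mono) auto
    also have "\<dots> \<le> (real t - real k) / (real t - real n)"
      using n that by (simp add: frac_le)
    finally show ?thesis using False by (simp add: chain_factor_def)
  qed
  have "(\<Sum>k\<le>t. real (t choose k) * (real k * (real t - real k))) = (\<Sum>k\<le>t. real t * (real k * real ((t - 1) choose k)))"
  proof (rule sum.cong[OF refl])
    fix k assume "k \<in> {..t}"
    have "real ((t - k) * (t choose k)) = real (t * ((t - 1) choose k))"
      by (simp only: binomial_absorb_comp)
    then have "(real t - real k) * real (t choose k) = real t * real ((t - 1) choose k)"
      using \<open>k \<in> {..t}\<close> by (simp add: of_nat_diff)
    then show "real (t choose k) * (real k * (real t - real k)) = real t * (real k * real ((t - 1) choose k))"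
      by (metis mult.assoc mult.commute)
  qed
  also have "\<dots> = real t * (\<Sum>k\<le>t - 1. real k * real ((t - 1) choose k))"
    unfolding sum_distrib_left using t
    by (intro sum.mono_neutral_right) (auto simp: binomial_eq_0)
  also have "\<dots> = real t * ((real t - 1) * 2 ^ (t - 2))"
    using t by (subst sum_choose_linear_real) (simp add: of_nat_diff numeral_2_eq_2)
  finally have *: "(\<Sum>k\<le>t. real (t choose k) * (real k * (real t - real k))) = real t * ((real t - 1) * 2 ^ (t - 2))" .
  have p: "(2::real) ^ t = 4 * 2 ^ (t - 2)"
  proof -
    have "(2::real) ^ (2 + (t - 2)) = 4 * 2 ^ (t - 2)" by (simp only: power_add) simp
    then show ?thesis using t by (simp only: le_add_diff_inverse)
  qed
  have "2 ^ t / 8 \<le> real t * ((real t - 1) * 2 ^ (t - 2)) / (real t)\<^sup>2"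
    using t unfolding p by (simp add: field_simps power2_eq_square)
  also have "\<dots> = (\<Sum>k\<le>t. real (t choose k) * (real k * (real t - real k) / (real t)\<^sup>2))"
    unfolding *[symmetric] sum_divide_distrib by simp
  also have "\<dots> \<le> (\<Sum>k\<le>t. real (t choose k) * chain_factor t n k)"
    using le by (intro sum_mono mult_left_mono) auto
  finally show ?thesis by (simp add: chain_gain_def field_simps)
qed

lemma sum_chain_kernel_sg:
  assumes T: "finite T" and S: "S \<subseteq> T" "card S = n" and n: "0 < n" "n < card T"
    and i: "i \<in> T"
  shows "(\<Sum>B\<in>Pow T. chain_kernel n T S B * sg B i)
    = chain_gain (card T) n * (2 ^ card T / real (card T choose n)) * (of_bool (i \<in> S) - real n / real (card T))"
proof -
  let ?t = "card T" and ?r = "of_bool (i \<in> S) - real n / real (card T) :: real"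
  have t0: "?t > 0" using n by simp
  have "(\<Sum>B\<in>Pow T. chain_kernel n T S B * sg B i)
      = (\<Sum>k\<le>?t. \<Sum>B | B \<in> Pow T \<and> card B = k. chain_kernel n T S B * sg B i)"
    using T by (intro sum.group[symmetric]) (auto intro: card_mono)
  also have "\<dots> = (\<Sum>k\<le>?t. real (?t choose k) / real (?t choose n) *
      (2 * (real k / real ?t + chain_factor ?t n k * ?r) - 1))"
    using sum_chain_kernel_sg_level[OF T S n i] by (intro sum.cong) auto
  also have "\<dots> = (2 / real ?t * (\<Sum>k\<le>?t. real k * real (?t choose k))
      + 2 * ?r * (\<Sum>k\<le>?t. real (?t choose k) * chain_factor ?t n k) - (\<Sum>k\<le>?t. real (?t choose k))) / real (?t choose n)"
    unfolding sum_distrib_left sum_subtractf[symmetric] sum.distrib[symmetric] sum_divide_distrib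
    by (intro sum.cong) (auto simp: algebra_simps divide_simps)
  \<comment> \<open>A uniform subset has mean size t/2. So this term cancels the -1 of the signs and
    only the multiple of the centered indicator remains.\<close>
  also have "2 / real ?t * (\<Sum>k\<le>?t. real k * real (?t choose k)) = 2 ^ ?t"
    using t0 unfolding sum_choose_linear_real by (cases ?t) auto
  also have "(\<Sum>k\<le>?t. real (?t choose k)) = 2 ^ ?t" by (rule sum_choose_real)
  finally show ?thesis by (simp add: chain_gain_def)
qed

text \<open>The Riesz product turns the signs of \<open>C\<close> on \<open>T\<close> into signs on all of \<open>I\<close> whose conditional mean
  given \<open>C\<close> carries the additional factor \<open>\<rho>\<close>.\<close>

definition srs_coef ::
    "nat \<Rightarrow> 'a set \<Rightarrow> 'a set \<Rightarrow> ('a \<Rightarrow> real) \<Rightarrow> 'a set \<Rightarrow> 'a set \<Rightarrow> real" where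
  "srs_coef n I T \<rho> S B =
     (if 0 < n \<and> n < card T then
        real (card T choose n) / (chain_gain (card T) n * 2 ^ card T) / 2 ^ card I *
        (\<Sum>C\<in>Pow T. chain_kernel n T S C * (\<Prod>i\<in>I. 1 + (of_bool (i \<in> T) * \<rho> i * sg C i) * sg B i))
      else 0)"

lemma srs_coef_nonneg:
  assumes \<rho>: "\<And>i. i \<in> T \<Longrightarrow> 0 \<le> \<rho> i \<and> \<rho> i \<le> 1"
  shows "0 \<le> srs_coef n I T \<rho> S B"
proof (cases "0 < n \<and> n < card T")
  case True
  have factor: "0 \<le> 1 + (of_bool (i \<in> T) * \<rho> i * sg C i) * sg B i" for i C
    using \<rho>[of i] by (cases "i \<in> T") (auto simp: sg_def)
  have "0 \<le> (\<Sum>C\<in>Pow T. chain_kernel n T S C * (\<Prod>i\<in>I. 1 + (of_bool (i \<in> T) * \<rho> i * sg C i) * sg B i))"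
    by (intro sum_nonneg mult_nonneg_nonneg prod_nonneg chain_kernel_nonneg factor)
  moreover have "0 \<le> real (card T choose n) / (chain_gain (card T) n * 2 ^ card T) / 2 ^ card I"
    using True chain_gain_ge[of n "card T"] by simp
  ultimately show ?thesis
    unfolding srs_coef_def if_P[OF True] by (rule mult_nonneg_nonneg[rotated])
next
  case False
  then show ?thesis unfolding srs_coef_def by (subst if_not_P) auto
qed

text \<open>Two layers of averaging: given \<open>C\<close>, the Riesz product gives unit
  \<open>i\<close> of \<open>T\<close> the mean sign \<open>\<rho> i * sg C i\<close> and every
  other unit mean 0; averaging over \<open>C\<close> produces the centered indicator times
  \<open>chain_gain\<close>, which the normalization removes.\<close>

lemma sum_srs_coef_sg:
  assumes I: "finite I" and T: "T \<subseteq> I" and S: "S \<subseteq> T" "card S = n" and i: "i \<in> I"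
  shows "(\<Sum>B\<in>Pow I. srs_coef n I T \<rho> S B * sg B i)
     = of_bool (i \<in> T) * ((of_bool (i \<in> S) - real n / real (card T)) * \<rho> i)"
proof -
  have fT: "finite T" using T I by (rule finite_subset)
  have le: "n \<le> card T" using S fT card_mono by blast
  \<comment> \<open>For an empty or a complete sample the centered indicators vanish on
    \<open>T\<close>, so the default value 0 of \<open>srs_coef\<close> is the right one.\<close>
  consider "n = 0" | "n = card T" "n \<noteq> 0" | "0 < n" "n < card T" using le by linarith
  then show ?thesis
  proof cases
    case 1
    then have "S = {}" using S finite_subset[OF S(1) fT] by simp
    then show ?thesis using 1 by (simp add: srs_coef_def)
  next
    case 2
    then have "S = T" using S fT card_subset_eq by blast
    then show ?thesis using 2 by (simp add: srs_coef_def)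
  next
    case 3
    let ?K = "real (card T choose n) / (chain_gain (card T) n * 2 ^ card T)"
    let ?a = "\<lambda>C i. of_bool (i \<in> T) * \<rho> i * sg C i"
    have coef: "srs_coef n I T \<rho> S B = ?K / 2 ^ card I *
        (\<Sum>C\<in>Pow T. chain_kernel n T S C * (\<Prod>i\<in>I. 1 + ?a C i * sg B i))" for B
      unfolding srs_coef_def using 3 by (simp only: simp_thms if_True)
    have "(\<Sum>B\<in>Pow I. srs_coef n I T \<rho> S B * sg B i)
      = (\<Sum>B\<in>Pow I. \<Sum>C\<in>Pow T. ?K / 2 ^ card I * chain_kernel n T S C *
          ((\<Prod>i\<in>I. 1 + ?a C i * sg B i) * sg B i))"
      by (simp only: coef sum_distrib_left sum_distrib_right mult.assoc)
    also have "\<dots> = (\<Sum>C\<in>Pow T. ?K / 2 ^ card I * chain_kernel n T S C *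
          (\<Sum>B\<in>Pow I. (\<Prod>i\<in>I. 1 + ?a C i * sg B i) * sg B i))"
      by (subst sum.swap) (simp only: sum_distrib_left)
    also have "\<dots> = (\<Sum>C\<in>Pow T. ?K / 2 ^ card I * chain_kernel n T S C * (2 ^ card I * ?a C i))"
      by (simp only: sum_Pow_riesz_sg[OF I i])
    also have "\<dots> = ?K * (of_bool (i \<in> T) * \<rho> i) * (\<Sum>C\<in>Pow T. chain_kernel n T S C * sg C i)"
      unfolding sum_distrib_left by (intro sum.cong refl) simp
    finally have *: "(\<Sum>B\<in>Pow I. srs_coef n I T \<rho> S B * sg B i)
      = ?K * (of_bool (i \<in> T) * \<rho> i) * (\<Sum>C\<in>Pow T. chain_kernel n T S C * sg C i)" .
    show ?thesis
    proof (cases "i \<in> T")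
      case False
      then show ?thesis unfolding * by simp
    next
      case True
      have "chain_gain (card T) n > 0" "real (card T choose n) > 0"
        using chain_gain_ge[OF 3] 3 by (auto simp: zero_less_binomial_iff)
      moreover have "c / (g * 2 ^ card T) * (1 * a) * (g * (2 ^ card T / c) * x) = 1 * (x * a)"
        if "g > 0" "c > 0" for c g a x :: real
        using that by (simp add: field_simps)
      ultimately show ?thesis
        unfolding * sum_chain_kernel_sg[OF fT S 3 True] using True by (simp only: of_bool_eq simp_thms)
    qed
  qed
qed

text \<open>This is the decoupling: the bound on the coefficient of \<open>B\<close>, summed over
  all samples, does not involve \<open>\<rho>\<close>, and it involves \<open>T\<close> and
  \<open>n\<close> only through the number of samples, which the averaging divides out.\<close>

lemma sum_srs_coef_le:
  assumes I: "finite I" and T: "T \<subseteq> I" and n: "n \<le> card T"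
    and \<rho>: "\<And>i. i \<in> T \<Longrightarrow> 0 \<le> \<rho> i \<and> \<rho> i \<le> 1"
  shows "(\<Sum>S | S \<subseteq> T \<and> card S = n. srs_coef n I T \<rho> S B) \<le> 4 / 2 ^ card I * real (card T choose n)"
proof (cases "0 < n \<and> n < card T")
  case True
  have fT: "finite T" using T I by (rule finite_subset)
  let ?K = "real (card T choose n) / (chain_gain (card T) n * 2 ^ card T) / 2 ^ card I"
  have coef: "srs_coef n I T \<rho> S B = ?K * (\<Sum>C\<in>Pow T. chain_kernel n T S C *
      (\<Prod>i\<in>I. 1 + (of_bool (i \<in> T) * \<rho> i * sg C i) * sg B i))" for S
    unfolding srs_coef_def using True by (simp only: simp_thms if_True)
  have "(\<Sum>S | S \<subseteq> T \<and> card S = n. srs_coef n I T \<rho> S B)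
     = (\<Sum>C\<in>Pow T. \<Sum>S | S \<subseteq> T \<and> card S = n.
          ?K * (chain_kernel n T S C * (\<Prod>i\<in>I. 1 + (of_bool (i \<in> T) * \<rho> i * sg C i) * sg B i)))"
    by (subst sum.swap) (simp only: coef sum_distrib_left)
  also have "\<dots> = ?K * (\<Sum>C\<in>Pow T. \<Prod>i\<in>I. 1 + (of_bool (i \<in> T) * \<rho> i * sg C i) * sg B i)"
    unfolding sum_distrib_left
    by (intro sum.cong refl)
      (simp only: sum_distrib_left[symmetric] sum_distrib_right[symmetric] sum_chain_kernel[OF fT _ n] Pow_iff mult_1)
  \<comment> \<open>The product is symmetric in the two sign vectors and its factors off
    \<open>T\<close> are 1. Read as a Riesz product in \<open>C\<close>, it has the same sum for
    every \<open>B\<close>.\<close>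
  also have "(\<Sum>C\<in>Pow T. \<Prod>i\<in>I. 1 + (of_bool (i \<in> T) * \<rho> i * sg C i) * sg B i)
      = (\<Sum>C\<in>Pow T. \<Prod>i\<in>T. 1 + (\<rho> i * sg B i) * sg C i)"
    using T I by (intro sum.cong refl prod.mono_neutral_cong_right) auto
  also have "\<dots> = 2 ^ card T" by (rule sum_Pow_riesz[OF fT])
  also have "?K * 2 ^ card T = real (card T choose n) / chain_gain (card T) n / 2 ^ card I" by simp
  also have "\<dots> \<le> real (card T choose n) / (1 / 4) / 2 ^ card I"
    using chain_gain_ge[of n "card T"] True by (intro divide_right_mono divide_left_mono) auto
  finally show ?thesis by (simp add: mult.commute)
next
  case False
  then have "srs_coef n I T \<rho> S B = 0" for S
    by (simp only: srs_coef_def if_False)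
  then show ?thesis by simp
qed

section \<open>A majorant for one simple random sample, common to all summands\<close>

definition srs_majorant ::
    "nat \<Rightarrow> 'a set \<Rightarrow> 'a set \<Rightarrow> ('a \<Rightarrow> real) \<Rightarrow> ('a set \<Rightarrow> ennreal) \<Rightarrow> 'a set \<Rightarrow> ennreal" where
  "srs_majorant n I T \<rho> D S = (\<Sum>B\<in>Pow I. ennreal (srs_coef n I T \<rho> S B) * D B)"

text \<open>The coefficients representing the centered indicators do not depend on \<open>y\<close>.
  Hence one finite combination of the \<open>D B\<close> dominates the sampling error for every
  \<open>y\<close> whose signed sums are below \<open>D\<close>, and a supremum over criterion
  functions costs nothing.\<close>

lemma abs_srs_sum_le_majorant:
  fixes y :: "'a \<Rightarrow> real"
  assumes I: "finite I" and T: "T \<subseteq> I" and S: "S \<subseteq> T" "card S = n"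
    and \<rho>: "\<And>i. i \<in> T \<Longrightarrow> 0 \<le> \<rho> i \<and> \<rho> i \<le> 1"
    and D: "\<And>B. B \<subseteq> I \<Longrightarrow> ennreal \<bar>\<Sum>i\<in>I. sg B i * y i\<bar> \<le> D B"
  shows "ennreal \<bar>\<Sum>i\<in>T. (of_bool (i \<in> S) - real n / real (card T)) * \<rho> i * y i\<bar> \<le> srs_majorant n I T \<rho> D S"
proof -
  have "(\<Sum>i\<in>T. (of_bool (i \<in> S) - real n / real (card T)) * \<rho> i * y i)
    = (\<Sum>i\<in>I. of_bool (i \<in> T) * ((of_bool (i \<in> S) - real n / real (card T)) * \<rho> i) * y i)"
    using T I by (intro sum.mono_neutral_cong_left) auto
  also have "\<dots> = (\<Sum>i\<in>I. \<Sum>B\<in>Pow I. srs_coef n I T \<rho> S B * (sg B i * y i))"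
    by (intro sum.cong refl)
      (simp only: sum_srs_coef_sg[OF I T S, symmetric] sum_distrib_right mult.assoc)
  also have "\<dots> = (\<Sum>B\<in>Pow I. srs_coef n I T \<rho> S B * (\<Sum>i\<in>I. sg B i * y i))"
    by (subst sum.swap) (simp only: sum_distrib_left)
  finally have "\<bar>\<Sum>i\<in>T. (of_bool (i \<in> S) - real n / real (card T)) * \<rho> i * y i\<bar>
     = \<bar>\<Sum>B\<in>Pow I. srs_coef n I T \<rho> S B * (\<Sum>i\<in>I. sg B i * y i)\<bar>" by simp
  also have "\<dots> \<le> (\<Sum>B\<in>Pow I. srs_coef n I T \<rho> S B * \<bar>\<Sum>i\<in>I. sg B i * y i\<bar>)"
    using srs_coef_nonneg[of T \<rho>, OF \<rho>] by (intro order_trans[OF sum_abs]) (simp add: abs_mult)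
  finally have "ennreal \<bar>\<Sum>i\<in>T. (of_bool (i \<in> S) - real n / real (card T)) * \<rho> i * y i\<bar>
     \<le> ennreal (\<Sum>B\<in>Pow I. srs_coef n I T \<rho> S B * \<bar>\<Sum>i\<in>I. sg B i * y i\<bar>)"
    by (rule ennreal_leI)
  also have "\<dots> = (\<Sum>B\<in>Pow I. ennreal (srs_coef n I T \<rho> S B) * ennreal \<bar>\<Sum>i\<in>I. sg B i * y i\<bar>)"
    using srs_coef_nonneg[of T \<rho>, OF \<rho>] by (subst sum_ennreal[symmetric]) (auto simp: ennreal_mult)
  also have "\<dots> \<le> srs_majorant n I T \<rho> D S"
    unfolding srs_majorant_def by (intro sum_mono mult_left_mono D) auto
  finally show ?thesis .
qed

text \<open>The left side is the mean over the simple random sample. On the right \<open>T\<close>,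
  \<open>n\<close> and \<open>\<rho>\<close>, all functions of the data in the application, are
  gone.\<close>

lemma sum_srs_majorant_le:
  assumes I: "finite I" and T: "T \<subseteq> I" and n: "n \<le> card T"
    and \<rho>: "\<And>i. i \<in> T \<Longrightarrow> 0 \<le> \<rho> i \<and> \<rho> i \<le> 1"
  shows "(\<Sum>S | S \<subseteq> T \<and> card S = n. srs_majorant n I T \<rho> D S) / of_nat (card T choose n)
     \<le> ennreal (4 / 2 ^ card I) * (\<Sum>B\<in>Pow I. D B)"
proof -
  let ?F = "{S. S \<subseteq> T \<and> card S = n}" and ?c = "ennreal (real (card T choose n))"
  have c: "?c \<noteq> 0" "?c \<noteq> \<top>" using n by (auto simp: zero_less_binomial_iff ennreal_eq_0_iff)
  have "(\<Sum>S\<in>?F. srs_majorant n I T \<rho> D S) = (\<Sum>B\<in>Pow I. (\<Sum>S\<in>?F. ennreal (srs_coef n I T \<rho> S B)) * D B)"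
    unfolding srs_majorant_def by (subst sum.swap) (simp only: sum_distrib_right)
  also have "\<dots> = (\<Sum>B\<in>Pow I. ennreal (\<Sum>S\<in>?F. srs_coef n I T \<rho> S B) * D B)"
    using srs_coef_nonneg[of T \<rho>, OF \<rho>] by (simp add: sum_ennreal)
  also have "\<dots> \<le> (\<Sum>B\<in>Pow I. ennreal (4 / 2 ^ card I * real (card T choose n)) * D B)"
    using sum_srs_coef_le[OF I T n \<rho>] by (intro sum_mono mult_right_mono ennreal_leI) auto
  also have "\<dots> = ?c * (ennreal (4 / 2 ^ card I) * (\<Sum>B\<in>Pow I. D B))"
  proof -
    have "ennreal (4 / 2 ^ card I * real (card T choose n)) = ?c * ennreal (4 / 2 ^ card I)"
      by (subst mult.commute, rule ennreal_mult) auto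
    then show ?thesis by (simp only: sum_distrib_left mult.assoc)
  qed
  finally have "(\<Sum>S\<in>?F. srs_majorant n I T \<rho> D S) / ?c \<le> ?c * (ennreal (4 / 2 ^ card I) * (\<Sum>B\<in>Pow I. D B)) / ?c"
    by (rule divide_right_mono_ennreal)
  also have "\<dots> = ennreal (4 / 2 ^ card I) * (\<Sum>B\<in>Pow I. D B)"
    unfolding mult.commute[of ?c] using c by (intro mult_divide_eq_ennreal)
  finally show ?thesis by (simp add: ennreal_of_nat_eq_real_of_nat)
qed

section \<open>Outer measure and partial sums of centered variables\<close>

lemma outer_measure_of_Un_le:
  "outer_measure_of M (A \<union> B) \<le> outer_measure_of M A + outer_measure_of M B"
proof (cases "A \<subseteq> space M \<and> B \<subseteq> space M")
  case True
  obtain E F where E: "E \<in> sets M" "A \<subseteq> E" "outer_measure_of M A = emeasure M E"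
    and F: "F \<in> sets M" "B \<subseteq> F" "outer_measure_of M B = emeasure M F"
    using True outer_measure_of_attain by metis
  have "outer_measure_of M (A \<union> B) \<le> outer_measure_of M (E \<union> F)"
    using E F by (intro outer_measure_of_mono) auto
  also have "\<dots> = emeasure M (E \<union> F)"
    using E F by (intro outer_measure_of_eq) auto
  also have "\<dots> \<le> emeasure M E + emeasure M F"
    using E F by (intro emeasure_subadditive)
  finally show ?thesis using E F by simp
next
  case False
  \<comment> \<open>A set that sticks out of the space has no measurable cover, and the infimum over
    the empty family is \<top>.\<close>
  then have "outer_measure_of M A = \<top> \<or> outer_measure_of M B = \<top>"
    using sets.sets_into_space by (fastforce simp: outer_measure_of_def intro: INF_eqI)
  then show ?thesis by auto
qed

lemma (in product_sigma_finite) nn_integral_PiM_restrict: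
  assumes "finite I" "A \<subseteq> I" and f: "f \<in> borel_measurable (PiM A M)"
    and prob: "\<And>i. prob_space (M i)"
  shows "(\<integral>\<^sup>+w. f (restrict w A) \<partial>PiM I M) = (\<integral>\<^sup>+w. f w \<partial>PiM A M)"
proof -
  have I: "I = A \<union> (I - A)" using assms by auto
  interpret p: prob_space "PiM (I - A) M" by (intro prob_space_PiM prob)
  have m: "(\<lambda>w. restrict w A) \<in> measurable (PiM (A \<union> (I - A)) M) (PiM A M)"
    by (rule measurable_restrict_subset) auto
  have "(\<integral>\<^sup>+w. f (restrict w A) \<partial>PiM (A \<union> (I - A)) M) =
     (\<integral>\<^sup>+x. (\<integral>\<^sup>+y. f (restrict (merge A (I - A) (x, y)) A) \<partial>PiM (I - A) M) \<partial>PiM A M)"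
    using assms finite_subset[of A I] by (intro product_nn_integral_fold measurable_compose[OF m f]) auto
  also have "\<dots> = (\<integral>\<^sup>+x. f x \<partial>PiM A M)"
  proof (intro nn_integral_cong)
    fix x assume "x \<in> space (PiM A M)"
    then have "restrict (merge A (I - A) (x, y)) A = x" for y
      by (auto simp: space_PiM PiE_def extensional_def merge_def restrict_def fun_eq_iff)
    then show "(\<integral>\<^sup>+y. f (restrict (merge A (I - A) (x, y)) A) \<partial>PiM (I - A) M) = f x"
      by (simp add: p.emeasure_space_1)
  qed
  finally show ?thesis using I by simp
qed

lemma integrable_PiM_component:
  assumes Q: "prob_space Q" and I: "finite I" "i \<in> I" and f: "integrable Q (f :: 'a \<Rightarrow> real)"
  shows "integrable (PiM I (\<lambda>_. Q)) (\<lambda>w. f (w i))"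
    and "(\<integral>w. f (w i) \<partial>PiM I (\<lambda>_. Q)) = (\<integral>x. f x \<partial>Q)"
proof -
  have d: "distr (PiM I (\<lambda>_. Q)) Q (\<lambda>w. w i) = Q"
    using Q I by (intro distr_PiM_component)
  have m: "(\<lambda>w. w i) \<in> measurable (PiM I (\<lambda>_. Q)) Q" using I by measurable
  show "integrable (PiM I (\<lambda>_. Q)) (\<lambda>w. f (w i))"
    using integrable_distr_eq[OF m, of f] f d by (metis borel_measurable_integrable)
  show "(\<integral>w. f (w i) \<partial>PiM I (\<lambda>_. Q)) = (\<integral>x. f x \<partial>Q)"
    using integral_distr[OF m, of f] f d by (metis borel_measurable_integrable)
qed

text \<open>The conditional expectation of \<open>Z\<close> given the coordinates in
  \<open>A\<close>, written as a partial integral so that it is defined at every point and can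
  dominate uncountably many functions at once.\<close>

definition subset_majorant ::
    "'a measure \<Rightarrow> 'i set \<Rightarrow> (('i \<Rightarrow> 'a) \<Rightarrow> ennreal) \<Rightarrow> 'i set \<Rightarrow> ('i \<Rightarrow> 'a) \<Rightarrow> ennreal" where
  "subset_majorant Q I Z A w =
     (\<integral>\<^sup>+ w'. Z (merge A (I - A) (restrict w A, w')) \<partial>PiM (I - A) (\<lambda>_. Q))"

context
  fixes Q :: "'a measure" and I A :: "'i set" and Z :: "('i \<Rightarrow> 'a) \<Rightarrow> ennreal"
  assumes Q: "prob_space Q" and I: "finite I" and A: "A \<subseteq> I"
    and Z [measurable]: "Z \<in> borel_measurable (PiM I (\<lambda>_. Q))"
begin

lemma measurable_subset_majorant_aux:
  "(\<lambda>x. \<integral>\<^sup>+ w'. Z (merge A (I - A) (x, w')) \<partial>PiM (I - A) (\<lambda>_. Q)) \<in> borel_measurable (PiM A (\<lambda>_. Q))"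
proof -
  interpret p: prob_space "PiM (I - A) (\<lambda>_. Q)" by (intro prob_space_PiM Q)
  have "merge A (I - A) \<in> measurable (PiM A (\<lambda>_. Q) \<Otimes>\<^sub>M PiM (I - A) (\<lambda>_. Q)) (PiM (A \<union> (I - A)) (\<lambda>_. Q))"
    by (rule measurable_merge)
  moreover have "A \<union> (I - A) = I" using A by auto
  ultimately have "(\<lambda>z. Z (merge A (I - A) z)) \<in> borel_measurable (PiM A (\<lambda>_. Q) \<Otimes>\<^sub>M PiM (I - A) (\<lambda>_. Q))"
    using Z by (auto intro: measurable_compose)
  then show ?thesis by (intro p.borel_measurable_nn_integral) (simp add: split_beta')
qed

lemma measurable_subset_majorant [measurable]:
  "subset_majorant Q I Z A \<in> borel_measurable (PiM I (\<lambda>_. Q))"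
  unfolding subset_majorant_def
  by (rule measurable_compose[OF _ measurable_subset_majorant_aux]) (rule measurable_restrict_subset[OF A])

text \<open>The tower property: passing from the full sum to a partial sum leaves the mean of the
  majorant unchanged.\<close>

lemma nn_integral_subset_majorant:
  "(\<integral>\<^sup>+ w. subset_majorant Q I Z A w \<partial>PiM I (\<lambda>_. Q)) = (\<integral>\<^sup>+ w. Z w \<partial>PiM I (\<lambda>_. Q))"
proof -
  interpret Q: prob_space Q by (rule Q)
  interpret product_sigma_finite "\<lambda>_. Q" ..
  have U: "A \<union> (I - A) = I" using A by auto
  have "(\<integral>\<^sup>+ w. subset_majorant Q I Z A w \<partial>PiM I (\<lambda>_. Q))
    = (\<integral>\<^sup>+ x. (\<integral>\<^sup>+ w'. Z (merge A (I - A) (x, w')) \<partial>PiM (I - A) (\<lambda>_. Q)) \<partial>PiM A (\<lambda>_. Q))"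
    unfolding subset_majorant_def
    by (rule nn_integral_PiM_restrict[OF I A measurable_subset_majorant_aux Q])
  also have "\<dots> = (\<integral>\<^sup>+ w. Z w \<partial>PiM (A \<union> (I - A)) (\<lambda>_. Q))"
  proof (rule product_nn_integral_fold[symmetric])
    show "Z \<in> borel_measurable (PiM (A \<union> (I - A)) (\<lambda>_. Q))"
      unfolding U by (rule Z)
  qed (use I finite_subset[OF A I] in auto)
  finally show ?thesis unfolding U .
qed

text \<open>Jensen's inequality: the coordinates outside \<open>A\<close> are centered, so averaging over an
  independent copy of them recovers the partial sum.\<close>

lemma abs_partial_sum_le_subset_majorant:
  fixes y :: "'a \<Rightarrow> real"
  assumes y: "integrable Q y" "(\<integral>x. y x \<partial>Q) = 0"
    and le: "\<And>w. w \<in> space (PiM I (\<lambda>_. Q)) \<Longrightarrow> ennreal \<bar>\<Sum>i\<in>I. y (w i)\<bar> \<le> Z w"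
    and w: "w \<in> space (PiM I (\<lambda>_. Q))"
  shows "ennreal \<bar>\<Sum>i\<in>A. y (w i)\<bar> \<le> subset_majorant Q I Z A w"
proof -
  let ?P = "PiM (I - A) (\<lambda>_. Q)"
  interpret p: prob_space ?P by (intro prob_space_PiM Q)
  have fin: "finite A" "finite (I - A)" using I A finite_subset by auto
  have int: "integrable ?P (\<lambda>w'. \<Sum>i\<in>I - A. y (w' i))"
    using integrable_PiM_component[OF Q fin(2) _ y(1)] by (intro Bochner_Integration.integrable_sum) auto
  have "(\<integral>w'. (\<Sum>i\<in>A. y (w i)) + (\<Sum>i\<in>I - A. y (w' i)) \<partial>?P) = (\<Sum>i\<in>A. y (w i)) + (\<Sum>i\<in>I - A. 0)"
    using int integrable_PiM_component[OF Q fin(2) _ y(1)] y(2)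
    by (subst Bochner_Integration.integral_add) (auto simp: p.prob_space)
  then have "ennreal \<bar>\<Sum>i\<in>A. y (w i)\<bar> = ennreal \<bar>\<integral>w'. (\<Sum>i\<in>A. y (w i)) + (\<Sum>i\<in>I - A. y (w' i)) \<partial>?P\<bar>"
    by simp
  also have "\<dots> \<le> ennreal (\<integral>w'. \<bar>(\<Sum>i\<in>A. y (w i)) + (\<Sum>i\<in>I - A. y (w' i))\<bar> \<partial>?P)"
    by (intro ennreal_leI integral_abs_bound)
  also have "\<dots> = (\<integral>\<^sup>+w'. ennreal \<bar>(\<Sum>i\<in>A. y (w i)) + (\<Sum>i\<in>I - A. y (w' i))\<bar> \<partial>?P)"
    using int by (intro nn_integral_eq_integral[symmetric]) auto
  also have "\<dots> \<le> subset_majorant Q I Z A w"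
    unfolding subset_majorant_def
  proof (rule nn_integral_mono)
    fix w' assume w': "w' \<in> space ?P"
    let ?v = "merge A (I - A) (restrict w A, w')"
    have "?v \<in> space (PiM I (\<lambda>_. Q))"
      using w w' A by (auto simp: space_PiM merge_def PiE_def extensional_def Pi_def)
    from le[OF this] have "ennreal \<bar>\<Sum>i\<in>I. y (?v i)\<bar> \<le> Z ?v" .
    moreover have "(\<Sum>i\<in>I. y (?v i)) = (\<Sum>i\<in>A. y (?v i)) + (\<Sum>i\<in>I - A. y (?v i))"
      by (subst sum.subset_diff[OF A I]) simp
    moreover have "\<dots> = (\<Sum>i\<in>A. y (w i)) + (\<Sum>i\<in>I - A. y (w' i))"
      by (intro arg_cong2[where f = "(+)"] sum.cong) (auto simp: merge_def)
    ultimately show "ennreal \<bar>(\<Sum>i\<in>A. y (w i)) + (\<Sum>i\<in>I - A. y (w' i))\<bar> \<le> Z ?v" by simp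
  qed
  finally show ?thesis .
qed

end

section \<open>Finite covers, dyadic shells and exceptional events\<close>

lemma outer_measure_of_UN_le:
  "finite I \<Longrightarrow> outer_measure_of M (\<Union>i\<in>I. A i) \<le> (\<Sum>i\<in>I. outer_measure_of M (A i))"
proof (induction I rule: finite_induct)
  case empty
  then show ?case using outer_measure_of_eq[of "{}" M] by simp
next
  case (insert i I)
  have "outer_measure_of M (A i \<union> (\<Union>i\<in>I. A i)) \<le> outer_measure_of M (A i) + (\<Sum>i\<in>I. outer_measure_of M (A i))"
    by (rule order_trans[OF outer_measure_of_Un_le add_left_mono[OF insert.IH]])
  then show ?case using insert.hyps by simp
qed

lemma dyadic_bracket:
  fixes x :: real
  assumes "2 ^ M < x"
  obtains s where "M \<le> s" "2 ^ s < x" "x \<le> 2 ^ Suc s"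
proof -
  define k where "k = (LEAST k. x \<le> 2 ^ k)"
  obtain k0 where "x < 2 ^ k0" using real_arch_pow[of 2 x] by auto
  from this have k: "x \<le> 2 ^ k" unfolding k_def by (rule LeastI[OF less_imp_le])
  then have "(2::real) ^ M < 2 ^ k" using assms by linarith
  then have "M < k" by simp
  moreover have "\<not> x \<le> 2 ^ (k - 1)"
    using \<open>M < k\<close> unfolding k_def by (intro not_less_Least) simp
  ultimately show thesis using k by (intro that[of "k - 1"]) (auto simp del: power_Suc)
qed

text \<open>The maximal inequality is stated in \<open>ereal\<close>, since \<open>ennreal\<close>
  would truncate a negative bound to 0. This is the passage back to \<open>ennreal\<close>.\<close>

lemma enn2ereal_le_ereal_iff: "0 \<le> y \<Longrightarrow> enn2ereal x \<le> ereal y \<longleftrightarrow> x \<le> ennreal y"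
  by (metis enn2ereal_ennreal less_eq_ennreal.rep_eq)

text \<open>Markov's inequality in the form of a measurable exceptional set; the events of interest
  need not be measurable and are covered by such sets.\<close>

lemma (in finite_measure) markov_event:
  assumes G: "G \<in> borel_measurable M" and le: "(\<integral>\<^sup>+x. G x \<partial>M) \<le> ennreal b" and t: "0 < t" and b: "0 \<le> b"
  obtains E where "E \<in> sets M" "emeasure M E \<le> ennreal (b / t)"
    "\<And>x. x \<in> space M - E \<Longrightarrow> G x < ennreal t"
proof
  let ?E = "{x \<in> space M. ennreal t \<le> G x}"
  show E: "?E \<in> sets M" using G by measurable
  have "ennreal t * emeasure M ?E = (\<integral>\<^sup>+x. ennreal t * indicator ?E x \<partial>M)"
    using E by (simp add: nn_integral_cmult_indicator)
  also have "\<dots> \<le> (\<integral>\<^sup>+x. G x \<partial>M)"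
    by (intro nn_integral_mono) (auto split: split_indicator)
  also note le
  finally have "ennreal t * emeasure M ?E \<le> ennreal b" .
  then have "ennreal (1 / t) * (ennreal t * emeasure M ?E) \<le> ennreal (1 / t) * ennreal b"
    by (rule mult_left_mono) simp
  moreover have "ennreal (1 / t) * (ennreal t * x) = x" for x
    using t by (simp add: mult.assoc[symmetric] ennreal_mult'[symmetric])
  moreover have "ennreal (1 / t) * ennreal b = ennreal (b / t)"
    using t b by (simp add: ennreal_mult'[symmetric])
  ultimately show "emeasure M ?E \<le> ennreal (b / t)" by simp
qed (auto simp: not_le)

section \<open>The weighted process under merged sampling\<close>

text \<open>The limits of the selection probabilities are kept out: the estimates hold for each
  fixed \<open>N\<close> on \<open>sampled_enough\<close>, and only
  \<open>undersampled_tendsto_0\<close> treats its complement.\<close>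

locale merged_sampling =
  fixes MX :: "'x measure" and MC :: "'c measure" and MU :: "'u measure"
    and Q :: "('x \<times> 'u) measure" and h :: "'x \<Rightarrow> 'c"
    and \<V> :: "'j::finite \<Rightarrow> ('c \<times> 'u) set"
    and n :: "nat \<Rightarrow> 'j \<Rightarrow> nat \<Rightarrow> nat" and \<rho> :: "'j \<Rightarrow> 'c \<times> 'u \<Rightarrow> real"
  assumes prob_Q: "prob_space Q" and sets_Q: "sets Q = sets (MX \<Otimes>\<^sub>M MU)"
    and h: "h \<in> measurable MX MC" and \<V>: "\<And>j. \<V> j \<in> sets (MC \<Otimes>\<^sub>M MU)"
    and cover: "AE w in Q. vval h w \<in> (\<Union>j. \<V> j)"
    and size_le: "\<And>N j k. k \<le> N \<Longrightarrow> n N j k \<le> k"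
    and weight: "weight_function \<V> \<rho>"
begin

section \<open>The joint law of data and samples\<close>

abbreviation "PM N \<equiv> PiM {..<N} (\<lambda>_. Q)"
abbreviation "samples N \<equiv> {S :: 'j \<Rightarrow> nat set. \<forall>j. S j \<subseteq> {..<N}}"
abbreviation "units N w \<equiv> source_units h \<V> N w"
abbreviation "ssize N w j \<equiv> sample_size h \<V> n N w j"
abbreviation "\<Omega> \<equiv> joint_law Q h \<V> n"

lemma finite_samples: "finite (samples N)"
proof -
  have "samples N = PiE UNIV (\<lambda>_. Pow {..<N})" by auto
  then show ?thesis by (simp add: finite_PiE)
qed

lemma units_subset: "units N w j \<subseteq> {..<N}"
  by (auto simp: source_units_def)

lemma finite_units [simp]: "finite (units N w j)"
  using units_subset by (rule finite_subset) simp

lemma size_le_card: "ssize N w j \<le> card (units N w j)"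
proof -
  have "card (units N w j) \<le> N" using card_mono[OF _ units_subset[of N w j]] by simp
  then show ?thesis by (simp add: sample_size_def size_le)
qed

lemma measurable_units: "units N \<in> measurable (PM N) (count_space (samples N))"
proof (subst measurable_count_space_eq2[OF finite_samples], intro conjI ballI)
  show "units N \<in> space (PM N) \<rightarrow> samples N" using units_subset by auto
  have vv: "vval h \<in> measurable Q (MC \<Otimes>\<^sub>M MU)"
    unfolding vval_def measurable_cong_sets[OF sets_Q refl] using h by measurable
  fix S :: "'j \<Rightarrow> nat set" assume S: "S \<in> samples N"
  have "units N -` {S} \<inter> space (PM N) =
     {w \<in> space (PM N). \<forall>j\<in>UNIV. \<forall>i\<in>{..<N}. vval h (w i) \<in> \<V> j \<longleftrightarrow> i \<in> S j}"
    using S by (fastforce simp: source_units_def fun_eq_iff set_eq_iff)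
  also have "\<dots> \<in> sets (PM N)"
  proof (intro sets.sets_Collect_finite_All finite)
    fix j i assume i: "i \<in> {..<N}"
    have "(\<lambda>w. vval h (w i)) \<in> measurable (PM N) (MC \<Otimes>\<^sub>M MU)"
      by (rule measurable_compose[OF measurable_component_singleton[OF i] vv])
    from measurable_sets[OF this \<V>[of j]]
    have "{w \<in> space (PM N). vval h (w i) \<in> \<V> j} \<in> sets (PM N)"
      by (simp add: vimage_def Int_def conj_commute)
    then show "{w \<in> space (PM N). vval h (w i) \<in> \<V> j \<longleftrightarrow> i \<in> S j} \<in> sets (PM N)"
      by (cases "i \<in> S j") (auto intro: sets.sets_Collect_neg)
  qed auto
  finally show "units N -` {S} \<inter> space (PM N) \<in> sets (PM N)" .
qed

lemma subsets_of_size_nonempty: "{A. A \<subseteq> units N w j \<and> card A = ssize N w j} \<noteq> {}"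
proof -
  obtain A where "A \<subseteq> units N w j" "card A = ssize N w j"
    using obtain_subset_with_card_n[OF size_le_card] by metis
  then show ?thesis by auto
qed

lemma set_selection_pmf:
  "set_pmf (selection_pmf h \<V> n N w) = {S. \<forall>j. S j \<subseteq> units N w j \<and> card (S j) = ssize N w j}"
proof -
  show ?thesis
    unfolding selection_pmf_def
    by (auto simp: set_Pi_pmf PiE_dflt_def set_pmf_of_set[OF subsets_of_size_nonempty])
qed

lemma nn_integral_selection_component:
  "(\<integral>\<^sup>+S. f (S j) \<partial>selection_pmf h \<V> n N w)
     = (\<Sum>A | A \<subseteq> units N w j \<and> card A = ssize N w j. f A) / of_nat (card (units N w j) choose ssize N w j)"
proof -
  let ?F = "{A. A \<subseteq> units N w j \<and> card A = ssize N w j}"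
  note ne = subsets_of_size_nonempty[of N w j]
  have fin: "finite ?F" by simp
  have "(\<integral>\<^sup>+S. f (S j) \<partial>selection_pmf h \<V> n N w) = (\<integral>\<^sup>+A. f A \<partial>map_pmf (\<lambda>S. S j) (selection_pmf h \<V> n N w))"
    by simp
  also have "map_pmf (\<lambda>S. S j) (selection_pmf h \<V> n N w) = pmf_of_set ?F"
    unfolding selection_pmf_def by (subst Pi_pmf_component) auto
  also have "(\<integral>\<^sup>+A. f A \<partial>pmf_of_set ?F) = sum f ?F / of_nat (card ?F)"
    by (simp only: nn_integral_pmf_of_set[OF ne fin] ennreal_of_nat_eq_real_of_nat)
  also have "card ?F = card (units N w j) choose ssize N w j" by (simp add: n_subsets)
  finally show ?thesis .
qed

lemma nn_integral_count_space_selection: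
  "(\<integral>\<^sup>+S. (case (w, S) of (w, S) \<Rightarrow> ennreal (pmf (selection_pmf h \<V> n N w) S)) * F (w, S) \<partial>count_space (samples N))
     = (\<integral>\<^sup>+S. F (w, S) \<partial>selection_pmf h \<V> n N w)"
proof -
  have "pmf (selection_pmf h \<V> n N w) S = 0" if "S \<notin> samples N" for S
    using that units_subset by (fastforce simp: pmf_eq_0_set_pmf set_selection_pmf)
  then show ?thesis
    unfolding nn_integral_measure_pmf prod.case by (intro nn_integral_count_space_eq) simp_all
qed

text \<open>Disintegration by Tonelli: the density with respect to counting measure is the
  conditional law of the samples, so the sampling can be averaged out for fixed data.\<close>

lemma nn_integral_joint_law:
  assumes F: "F \<in> borel_measurable (PM N \<Otimes>\<^sub>M count_space (samples N))"
  shows "(\<integral>\<^sup>+z. F z \<partial>\<Omega> N) = (\<integral>\<^sup>+w. (\<integral>\<^sup>+S. F (w, S) \<partial>selection_pmf h \<V> n N w) \<partial>PM N)"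
proof -
  interpret C: sigma_finite_measure "count_space (samples N)"
    by (rule sigma_finite_measure_count_space_finite[OF finite_samples])
  let ?d = "\<lambda>(w, S). ennreal (pmf (selection_pmf h \<V> n N w) S)"
  have d: "?d \<in> borel_measurable (PM N \<Otimes>\<^sub>M count_space (samples N))"
    by (rule measurable_selection_pmf[OF sets_Q h \<V>])
  have "(\<integral>\<^sup>+z. F z \<partial>\<Omega> N) = (\<integral>\<^sup>+z. ?d z * F z \<partial>(PM N \<Otimes>\<^sub>M count_space (samples N)))"
    unfolding joint_law_def by (rule nn_integral_density[OF d F])
  also have "\<dots> = (\<integral>\<^sup>+w. (\<integral>\<^sup>+S. ?d (w, S) * F (w, S) \<partial>count_space (samples N)) \<partial>PM N)"
    using d F by (intro C.nn_integral_fst[symmetric] borel_measurable_times) auto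
  also have "\<dots> = (\<integral>\<^sup>+w. (\<integral>\<^sup>+S. F (w, S) \<partial>selection_pmf h \<V> n N w) \<partial>PM N)"
    by (simp only: nn_integral_count_space_selection)
  finally show ?thesis .
qed

lemma sets_joint_law: "sets (\<Omega> N) = sets (PM N \<Otimes>\<^sub>M count_space (samples N))"
  by (simp add: joint_law_def)

lemma space_joint_law: "space (\<Omega> N) = space (PM N) \<times> samples N"
  by (simp add: joint_law_def space_pair_measure)

lemma measurable_fst_joint_law:
  "g \<in> borel_measurable (PM N) \<Longrightarrow> (\<lambda>z. g (fst z)) \<in> borel_measurable (\<Omega> N)"
  by (subst measurable_cong_sets[OF sets_joint_law refl]) simp

lemma nn_integral_fst_joint_law:
  assumes [measurable]: "g \<in> borel_measurable (PM N)"
  shows "(\<integral>\<^sup>+z. g (fst z) \<partial>\<Omega> N) = (\<integral>\<^sup>+w. g w \<partial>PM N)"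
  by (subst nn_integral_joint_law) (auto simp: measure_pmf.emeasure_space_1[simplified])

text \<open>What holds only almost surely: the joint space also contains data outside all sources,
  and samples of the wrong size or with foreign units, where the density vanishes.\<close>

definition valid :: "nat \<Rightarrow> (nat \<Rightarrow> 'x \<times> 'u) \<times> ('j \<Rightarrow> nat set) \<Rightarrow> bool" where
  "valid N = (\<lambda>(w, S). (\<forall>i<N. vval h (w i) \<in> (\<Union>j. \<V> j)) \<and>
     (\<forall>j. S j \<subseteq> units N w j \<and> card (S j) = ssize N w j))"

lemma AE_valid: "AE z in \<Omega> N. valid N z"
proof -
  have "AE w in PM N. \<forall>i\<in>{..<N}. vval h (w i) \<in> (\<Union>j. \<V> j)"
    by (intro AE_finite_allI finite_lessThan AE_PiM_component prob_Q cover)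
  then obtain E where E: "{w \<in> space (PM N). \<not> (\<forall>i\<in>{..<N}. vval h (w i) \<in> (\<Union>j. \<V> j))} \<subseteq> E"
      "E \<in> sets (PM N)" "emeasure (PM N) E = 0"
    by (elim AE_E)
  have "(\<integral>\<^sup>+z. indicator E (fst z) \<partial>\<Omega> N) = (0::ennreal)"
    using E(2,3) by (subst nn_integral_fst_joint_law) auto
  then have 1: "AE z in \<Omega> N. indicator E (fst z) = (0::ennreal)"
    using E(2) measurable_fst_joint_law[of "indicator E" N] by (subst (asm) nn_integral_0_iff_AE) auto
  have 2: "AE z in \<Omega> N. 0 < (\<lambda>(w, S). ennreal (pmf (selection_pmf h \<V> n N w) S)) z"
    unfolding joint_law_def AE_density[OF measurable_selection_pmf[OF sets_Q h \<V>]] by simp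
  show ?thesis
    using 1 2 AE_space
  proof eventually_elim
    case (elim z)
    obtain w S where z: "z = (w, S)" by (cases z)
    have "w \<notin> E" "w \<in> space (PM N)" "S \<in> set_pmf (selection_pmf h \<V> n N w)"
      using elim by (auto simp: z space_joint_law set_pmf_iff split: split_indicator_asm)
    moreover have "\<forall>i\<in>{..<N}. vval h (w i) \<in> (\<Union>j. \<V> j)" using calculation E(1) by blast
    ultimately show ?case by (simp add: valid_def z set_selection_pmf)
  qed
qed

text \<open>By \<^const>\<open>weight_function\<close>, the weight of a unit depends only on the set of sources it belongs
  to. Expressing it through the latter makes it measurable without any assumption on \<open>\<rho>\<close>.\<close>

definition region_weight :: "('j \<Rightarrow> nat set) \<Rightarrow> 'j \<Rightarrow> nat \<Rightarrow> real" where
  "region_weight T j i = \<rho> j (SOME v. \<forall>k. v \<in> \<V> k \<longleftrightarrow> i \<in> T k)"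

text \<open>Unit \<open>i\<close> itself witnesses the choice, so the chosen point has the same
  source memberships. The hypothesis places both points in the union of the sources, where
  \<open>\<rho>\<close> is constant on regions.\<close>

lemma region_weight_units:
  assumes "i \<in> units N w k"
  shows "region_weight (units N w) j i = \<rho> j (vval h (w i))"
proof -
  let ?v = "SOME v. \<forall>k. v \<in> \<V> k \<longleftrightarrow> i \<in> units N w k"
  have i: "i < N" "vval h (w i) \<in> \<V> k" using assms by (auto simp: source_units_def)
  have "\<forall>k. vval h (w i) \<in> \<V> k \<longleftrightarrow> i \<in> units N w k" using i by (auto simp: source_units_def)
  then have "\<forall>k. ?v \<in> \<V> k \<longleftrightarrow> i \<in> units N w k" by (rule someI)
  then have "\<forall>k. ?v \<in> \<V> k \<longleftrightarrow> vval h (w i) \<in> \<V> k" using i by (auto simp: source_units_def)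
  then show ?thesis
    using weight i unfolding weight_function_def region_weight_def by blast
qed

lemma region_weight_bounds:
  assumes "i \<in> units N w k"
  shows "0 \<le> region_weight (units N w) j i \<and> region_weight (units N w) j i \<le> 1"
proof -
  have "vval h (w i) \<in> (\<Union>j. \<V> j)" using assms by (auto simp: source_units_def)
  then show ?thesis
    using weight unfolding weight_function_def region_weight_units[OF assms] by blast
qed

definition design_majorant ::
    "nat \<Rightarrow> 'j \<Rightarrow> (nat set \<Rightarrow> (nat \<Rightarrow> 'x \<times> 'u) \<Rightarrow> ennreal) \<Rightarrow>
     (nat \<Rightarrow> 'x \<times> 'u) \<times> ('j \<Rightarrow> nat set) \<Rightarrow> ennreal" where
  "design_majorant N j D = (\<lambda>(w, S).
     srs_majorant (ssize N w j) {..<N} (units N w j) (region_weight (units N w) j) (\<lambda>B. D B w) (S j))"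

text \<open>The coefficients depend on the data only through \<open>units N w\<close>, which has
  finitely many values; \<open>region_weight\<close> is what makes this true of the factor
  \<open>\<rho>\<close>.\<close>

lemma measurable_design_majorant:
  assumes D: "\<And>B. B \<subseteq> {..<N} \<Longrightarrow> D B \<in> borel_measurable (PM N)"
  shows "design_majorant N j D \<in> borel_measurable (PM N \<Otimes>\<^sub>M count_space (samples N))"
proof -
  define G where "G B T S = ennreal (srs_coef (n N j (card (T j))) {..<N} (T j) (region_weight T j) (S j) B)"
    for B T and S :: "'j \<Rightarrow> nat set"
  have G: "(\<lambda>z. G B (units N (fst z)) (snd z)) \<in> borel_measurable (PM N \<Otimes>\<^sub>M count_space (samples N))" for B
  proof (rule measurable_compose_countable'[where I = "samples N" and g = snd])
    fix S
    show "(\<lambda>z. G B (units N (fst z)) S) \<in> borel_measurable (PM N \<Otimes>\<^sub>M count_space (samples N))"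
      by (rule measurable_compose[OF measurable_compose[OF measurable_fst measurable_units]]) simp
  qed (use finite_samples countable_finite in auto)
  have "design_majorant N j D = (\<lambda>z. \<Sum>B\<in>Pow {..<N}. G B (units N (fst z)) (snd z) * D B (fst z))"
    by (simp add: design_majorant_def srs_majorant_def G_def sample_size_def case_prod_beta' fun_eq_iff)
  then show ?thesis
    using G D by (auto intro!: borel_measurable_sum borel_measurable_times measurable_compose[OF measurable_fst])
qed

lemma nn_integral_design_majorant_le:
  assumes D: "\<And>B. B \<subseteq> {..<N} \<Longrightarrow> D B \<in> borel_measurable (PM N)"
  shows "(\<integral>\<^sup>+z. design_majorant N j D z \<partial>\<Omega> N)
     \<le> ennreal (4 / 2 ^ N) * (\<Sum>B\<in>Pow {..<N}. \<integral>\<^sup>+w. D B w \<partial>PM N)"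
proof -
  have "(\<integral>\<^sup>+z. design_majorant N j D z \<partial>\<Omega> N)
      = (\<integral>\<^sup>+w. (\<integral>\<^sup>+S. design_majorant N j D (w, S) \<partial>selection_pmf h \<V> n N w) \<partial>PM N)"
    by (rule nn_integral_joint_law[OF measurable_design_majorant[OF D]])
  also have "\<dots> \<le> (\<integral>\<^sup>+w. ennreal (4 / 2 ^ N) * (\<Sum>B\<in>Pow {..<N}. D B w) \<partial>PM N)"
  proof (rule nn_integral_mono)
    fix w
    show "(\<integral>\<^sup>+S. design_majorant N j D (w, S) \<partial>selection_pmf h \<V> n N w)
       \<le> ennreal (4 / 2 ^ N) * (\<Sum>B\<in>Pow {..<N}. D B w)"
      using sum_srs_majorant_le[OF finite_lessThan units_subset[of N w j] size_le_card
          region_weight_bounds, where D = "\<lambda>B. D B w"]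
      unfolding design_majorant_def prod.case by (subst nn_integral_selection_component) simp
  qed
  also have "\<dots> = ennreal (4 / 2 ^ N) * (\<Sum>B\<in>Pow {..<N}. \<integral>\<^sup>+w. D B w \<partial>PM N)"
    using D by (subst nn_integral_cmult, force intro!: borel_measurable_sum, subst nn_integral_sum) auto
  finally show ?thesis .
qed

definition weighted_sum ::
    "nat \<Rightarrow> (nat \<Rightarrow> 'x \<times> 'u) \<times> ('j \<Rightarrow> nat set) \<Rightarrow> (nat \<Rightarrow> real) \<Rightarrow> real" where
  "weighted_sum N = (\<lambda>(w, S) y. \<Sum>i<N. \<Sum>j\<in>UNIV.
     of_bool (i \<in> S j) * \<rho> j (vval h (w i)) / sel_prob h \<V> n N w j (vval h (w i)) * y i)"

text \<open>A source without units contributes nothing, and its fraction 0/0 = 0 would violate the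
  bound; hence the restriction to nonempty sources.\<close>

definition sampled_enough :: "nat \<Rightarrow> real \<Rightarrow> (nat \<Rightarrow> 'x \<times> 'u) \<times> ('j \<Rightarrow> nat set) \<Rightarrow> bool" where
  "sampled_enough N \<kappa> = (\<lambda>(w, S). \<forall>j. units N w j \<noteq> {} \<longrightarrow> \<kappa> \<le> real (ssize N w j) / real (card (units N w j)))"

lemma weighted_sum_error_le:
  assumes v: "valid N (w, S)" and s: "sampled_enough N \<kappa> (w, S)" and \<kappa>: "0 < \<kappa>"
    and D: "\<And>B. B \<subseteq> {..<N} \<Longrightarrow> ennreal \<bar>\<Sum>i<N. sg B i * y i\<bar> \<le> D B w"
  shows "ennreal \<bar>weighted_sum N (w, S) y - (\<Sum>i<N. y i)\<bar>
     \<le> ennreal (1 / \<kappa>) * (\<Sum>j\<in>UNIV. design_majorant N j D (w, S))"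
proof -
  define f where "f j = real (ssize N w j) / real (card (units N w j))" for j
  define e where "e j = (\<Sum>i\<in>units N w j. (of_bool (i \<in> S j) - f j) * region_weight (units N w) j i * y i)" for j
  have S: "S j \<subseteq> units N w j" "card (S j) = ssize N w j" for j
    using v by (auto simp: valid_def)
  have f_ge: "\<kappa> \<le> f j" if "units N w j \<noteq> {}" for j
    using s that by (auto simp: sampled_enough_def f_def)
  \<comment> \<open>\<open>\<rho>\<close> vanishes outside the sources of a unit, so restricting the
    sum to these sources keeps the total 1.\<close>
  have one: "(\<Sum>j\<in>UNIV. if i \<in> units N w j then \<rho> j (vval h (w i)) else 0) = 1" if "i < N" for i
  proof -
    have V: "vval h (w i) \<in> (\<Union>j. \<V> j)" using v that by (auto simp: valid_def)
    then have "\<forall>j. vval h (w i) \<notin> \<V> j \<longrightarrow> \<rho> j (vval h (w i)) = 0" "(\<Sum>j\<in>UNIV. \<rho> j (vval h (w i))) = 1"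
      using weight unfolding weight_function_def by blast+
    moreover from this(1) have "(\<Sum>j\<in>UNIV. if i \<in> units N w j then \<rho> j (vval h (w i)) else 0)
        = (\<Sum>j\<in>UNIV. \<rho> j (vval h (w i)))"
      using that by (intro sum.cong) (auto simp: source_units_def)
    ultimately show ?thesis by simp
  qed
  have source: "(\<Sum>i<N. of_bool (i \<in> S j) * \<rho> j (vval h (w i)) / sel_prob h \<V> n N w j (vval h (w i)) * y i)
      = (\<Sum>i\<in>units N w j. \<rho> j (vval h (w i)) * y i) + e j / f j" for j
  proof -
    have "(\<Sum>i<N. of_bool (i \<in> S j) * \<rho> j (vval h (w i)) / sel_prob h \<V> n N w j (vval h (w i)) * y i)
      = (\<Sum>i\<in>units N w j. of_bool (i \<in> S j) * \<rho> j (vval h (w i)) / f j * y i)"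
      using S units_subset by (intro sum.mono_neutral_cong_right) (auto simp: sel_prob_def f_def source_units_def)
    \<comment> \<open>Exact splitting R \<rho> / f = \<rho> + (R - f) \<rho> / f. Over all sources
      the first terms add up to the unweighted sum.\<close>
    also have "\<dots> = (\<Sum>i\<in>units N w j. \<rho> j (vval h (w i)) * y i
        + (of_bool (i \<in> S j) - f j) * region_weight (units N w) j i * y i / f j)"
    proof (rule sum.cong[OF refl])
      fix i assume i: "i \<in> units N w j"
      then have "0 < f j" using f_ge[of j] \<kappa> by force
      then show "of_bool (i \<in> S j) * \<rho> j (vval h (w i)) / f j * y i = \<rho> j (vval h (w i)) * y i
        + (of_bool (i \<in> S j) - f j) * region_weight (units N w) j i * y i / f j"
        unfolding region_weight_units[OF i] by (simp add: field_simps)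
    qed
    finally show ?thesis by (simp only: sum.distrib sum_divide_distrib e_def)
  qed
  have "(\<Sum>j\<in>UNIV. \<Sum>i\<in>units N w j. \<rho> j (vval h (w i)) * y i)
      = (\<Sum>j\<in>UNIV. \<Sum>i<N. (if i \<in> units N w j then \<rho> j (vval h (w i)) else 0) * y i)"
    using units_subset by (intro sum.cong refl sum.mono_neutral_cong_left) auto
  also have "\<dots> = (\<Sum>i<N. (\<Sum>j\<in>UNIV. if i \<in> units N w j then \<rho> j (vval h (w i)) else 0) * y i)"
    by (subst sum.swap) (simp only: sum_distrib_right)
  also have "\<dots> = (\<Sum>i<N. y i)" using one by simp
  finally have main: "(\<Sum>j\<in>UNIV. \<Sum>i\<in>units N w j. \<rho> j (vval h (w i)) * y i) = (\<Sum>i<N. y i)" .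
  have "weighted_sum N (w, S) y = (\<Sum>i<N. y i) + (\<Sum>j\<in>UNIV. e j / f j)"
    unfolding weighted_sum_def prod.case by (subst sum.swap) (simp only: source sum.distrib main)
  then have "\<bar>weighted_sum N (w, S) y - (\<Sum>i<N. y i)\<bar> \<le> (\<Sum>j\<in>UNIV. \<bar>e j / f j\<bar>)"
    using sum_abs[of "\<lambda>j. e j / f j" UNIV] by simp
  also have "\<dots> \<le> (\<Sum>j\<in>UNIV. 1 / \<kappa> * \<bar>e j\<bar>)"
  proof (rule sum_mono)
    fix j
    show "\<bar>e j / f j\<bar> \<le> 1 / \<kappa> * \<bar>e j\<bar>"
    proof (cases "units N w j = {}")
      case False
      then have "\<bar>e j\<bar> / \<bar>f j\<bar> \<le> \<bar>e j\<bar> / \<kappa>"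
        using f_ge[OF False] \<kappa> by (intro divide_left_mono) auto
      then show ?thesis by (simp add: abs_divide)
    qed (simp add: e_def)
  qed
  finally have "ennreal \<bar>weighted_sum N (w, S) y - (\<Sum>i<N. y i)\<bar> \<le> ennreal (1 / \<kappa> * (\<Sum>j\<in>UNIV. \<bar>e j\<bar>))"
    by (intro ennreal_leI) (simp add: sum_distrib_left)
  also have "\<dots> = ennreal (1 / \<kappa>) * (\<Sum>j\<in>UNIV. ennreal \<bar>e j\<bar>)"
    using \<kappa> by (subst ennreal_mult) (auto intro: sum_nonneg simp: sum_ennreal)
  also have "\<dots> \<le> ennreal (1 / \<kappa>) * (\<Sum>j\<in>UNIV. design_majorant N j D (w, S))"
    unfolding design_majorant_def prod.case e_def f_def
    by (intro mult_left_mono sum_mono abs_srs_sum_le_majorant finite_lessThan units_subset S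
        region_weight_bounds D) auto
  finally show ?thesis .
qed

lemma prob_space_joint: "prob_space (\<Omega> N)"
  by (rule prob_space_joint_law[OF prob_Q sets_Q h \<V> size_le])

lemma measurable_nn_integral_selection:
  assumes F: "F \<in> borel_measurable (PM N \<Otimes>\<^sub>M count_space (samples N))"
  shows "(\<lambda>w. \<integral>\<^sup>+S. F (w, S) \<partial>selection_pmf h \<V> n N w) \<in> borel_measurable (PM N)"
proof -
  interpret C: sigma_finite_measure "count_space (samples N)"
    by (rule sigma_finite_measure_count_space_finite[OF finite_samples])
  let ?d = "\<lambda>(w, S). ennreal (pmf (selection_pmf h \<V> n N w) S)"
  have d: "?d \<in> borel_measurable (PM N \<Otimes>\<^sub>M count_space (samples N))"
    by (rule measurable_selection_pmf[OF sets_Q h \<V>])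
  have "(\<lambda>z. ?d z * F z) \<in> borel_measurable (PM N \<Otimes>\<^sub>M count_space (samples N))"
    using d F by (rule borel_measurable_times_ennreal)
  then have "(\<lambda>w. \<integral>\<^sup>+S. ?d (w, S) * F (w, S) \<partial>count_space (samples N)) \<in> borel_measurable (PM N)"
    by (intro C.borel_measurable_nn_integral) (simp add: split_beta')
  then show ?thesis by (simp only: nn_integral_count_space_selection)
qed

text \<open>A map that ignores the sampling indicators has a majorant that ignores them too: average a
  joint majorant over the conditional law of the samples.\<close>

lemma outer_expectation_majorant:
  assumes "outer_expectation (\<Omega> N) (\<lambda>(w, S). T w) < b"
  obtains Z where "Z \<in> borel_measurable (PM N)" "(\<integral>\<^sup>+w. Z w \<partial>PM N) \<le> b"
    "\<And>w. w \<in> space (PM N) \<Longrightarrow> T w \<le> Z w"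
proof -
  obtain Y where Y: "Y \<in> borel_measurable (\<Omega> N)" "\<And>z. z \<in> space (\<Omega> N) \<Longrightarrow> T (fst z) \<le> Y z"
      "(\<integral>\<^sup>+z. Y z \<partial>\<Omega> N) < b"
    using assms unfolding outer_expectation_def INF_less_iff by (auto simp: case_prod_beta')
  have Ym: "Y \<in> borel_measurable (PM N \<Otimes>\<^sub>M count_space (samples N))"
    using Y(1) by (simp add: measurable_cong_sets[OF sets_joint_law refl])
  show thesis
  proof
    show "(\<lambda>w. \<integral>\<^sup>+S. Y (w, S) \<partial>selection_pmf h \<V> n N w) \<in> borel_measurable (PM N)"
      by (rule measurable_nn_integral_selection[OF Ym])
    show "(\<integral>\<^sup>+w. \<integral>\<^sup>+S. Y (w, S) \<partial>selection_pmf h \<V> n N w \<partial>PM N) \<le> b"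
      using Y(3) nn_integral_joint_law[OF Ym] by simp
    fix w assume w: "w \<in> space (PM N)"
    have "T w = (\<integral>\<^sup>+S. T w \<partial>selection_pmf h \<V> n N w)"
      by (simp add: measure_pmf.emeasure_space_1[simplified])
    also have "\<dots> \<le> (\<integral>\<^sup>+S. Y (w, S) \<partial>selection_pmf h \<V> n N w)"
    proof (rule nn_integral_mono_AE, unfold AE_measure_pmf_iff, intro ballI)
      fix S assume "S \<in> set_pmf (selection_pmf h \<V> n N w)"
      then have "S \<in> samples N" using units_subset by (fastforce simp: set_selection_pmf)
      then show "T w \<le> Y (w, S)" using Y(2)[of "(w, S)"] w by (simp add: space_joint_law)
    qed
    finally show "T w \<le> (\<integral>\<^sup>+S. Y (w, S) \<partial>selection_pmf h \<V> n N w)" .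
  qed
qed

text \<open>In the constant, 1 accounts for the unweighted sum; each source contributes 1/\<kappa>
  for the inverse selection fraction, 4 for the coupling, and 2 for writing a signed sum as a
  difference of two partial sums. \<open>G\<close> is fixed before \<open>y\<close>, so it serves a
  whole class.\<close>

lemma weighted_sum_majorant:
  assumes \<kappa>: "0 < \<kappa>" and Z: "Z \<in> borel_measurable (PM N)"
  obtains G where "G \<in> borel_measurable (\<Omega> N)"
    "(\<integral>\<^sup>+z. G z \<partial>\<Omega> N) \<le> ennreal (1 + 8 * real CARD('j) / \<kappa>) * (\<integral>\<^sup>+w. Z w \<partial>PM N)"
    "\<And>w S y. \<lbrakk>(w, S) \<in> space (\<Omega> N); valid N (w, S); sampled_enough N \<kappa> (w, S);
        integrable Q y; (\<integral>x. y x \<partial>Q) = 0;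
        \<And>w. w \<in> space (PM N) \<Longrightarrow> ennreal \<bar>\<Sum>i<N. y (w i)\<bar> \<le> Z w\<rbrakk>
      \<Longrightarrow> ennreal \<bar>weighted_sum N (w, S) (\<lambda>i. y (w i))\<bar> \<le> G (w, S)"
proof -
  let ?I = "{..<N}"
  define D where "D B w = subset_majorant Q ?I Z B w + subset_majorant Q ?I Z (?I - B) w" for B w
  have Dm: "D B \<in> borel_measurable (PM N)" if "B \<subseteq> ?I" for B
    unfolding D_def
    by (intro borel_measurable_add measurable_subset_majorant[OF prob_Q finite_lessThan _ Z]) (use that in auto)
  have Di: "(\<integral>\<^sup>+w. D B w \<partial>PM N) = 2 * (\<integral>\<^sup>+w. Z w \<partial>PM N)" if "B \<subseteq> ?I" for B
  proof -
    have "(\<integral>\<^sup>+w. D B w \<partial>PM N) = (\<integral>\<^sup>+w. subset_majorant Q ?I Z B w \<partial>PM N) + (\<integral>\<^sup>+w. subset_majorant Q ?I Z (?I - B) w \<partial>PM N)"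
      unfolding D_def
      by (intro nn_integral_add measurable_subset_majorant[OF prob_Q finite_lessThan _ Z]) (use that in auto)
    also have "\<dots> = (\<integral>\<^sup>+w. Z w \<partial>PM N) + (\<integral>\<^sup>+w. Z w \<partial>PM N)"
      using that by (simp add: nn_integral_subset_majorant[OF prob_Q finite_lessThan _ Z])
    finally show ?thesis by (simp add: mult_2)
  qed
  define G where "G z = Z (fst z) + ennreal (1 / \<kappa>) * (\<Sum>j\<in>UNIV. design_majorant N j D z)" for z
  have Gd: "design_majorant N j D \<in> borel_measurable (\<Omega> N)" for j
    using measurable_design_majorant[OF Dm] by (simp add: measurable_cong_sets[OF sets_joint_law refl])
  show thesis
  proof
    show "G \<in> borel_measurable (\<Omega> N)"
      unfolding G_def using measurable_fst_joint_law[OF Z] Gd by measurable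
    have "(\<integral>\<^sup>+z. G z \<partial>\<Omega> N) = (\<integral>\<^sup>+w. Z w \<partial>PM N)
        + ennreal (1 / \<kappa>) * (\<Sum>j\<in>UNIV. \<integral>\<^sup>+z. design_majorant N j D z \<partial>\<Omega> N)"
      unfolding G_def using measurable_fst_joint_law[OF Z] Gd
      by (simp add: nn_integral_add nn_integral_cmult nn_integral_sum nn_integral_fst_joint_law[OF Z])
    also have "\<dots> \<le> (\<integral>\<^sup>+w. Z w \<partial>PM N)
        + ennreal (1 / \<kappa>) * (\<Sum>j\<in>(UNIV::'j set). ennreal 8 * (\<integral>\<^sup>+w. Z w \<partial>PM N))"
    proof (intro add_left_mono mult_left_mono sum_mono)
      fix j
      have "(\<integral>\<^sup>+z. design_majorant N j D z \<partial>\<Omega> N)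
          \<le> ennreal (4 / 2 ^ N) * (\<Sum>B\<in>Pow ?I. \<integral>\<^sup>+w. D B w \<partial>PM N)"
        by (rule nn_integral_design_majorant_le[OF Dm])
      also have "(\<Sum>B\<in>Pow ?I. \<integral>\<^sup>+w. D B w \<partial>PM N) = (\<Sum>B\<in>Pow ?I. 2 * (\<integral>\<^sup>+w. Z w \<partial>PM N))"
        using Di by (intro sum.cong) auto
      also have "\<dots> = ennreal (2 ^ N * 2) * (\<integral>\<^sup>+w. Z w \<partial>PM N)"
        by (simp add: card_Pow ennreal_mult' mult.assoc flip: ennreal_power)
      also have "ennreal (4 / 2 ^ N) * (ennreal (2 ^ N * 2) * (\<integral>\<^sup>+w. Z w \<partial>PM N)) = ennreal 8 * (\<integral>\<^sup>+w. Z w \<partial>PM N)"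
        unfolding mult.assoc[symmetric] by (subst ennreal_mult[symmetric]) auto
      finally show "(\<integral>\<^sup>+z. design_majorant N j D z \<partial>\<Omega> N) \<le> ennreal 8 * (\<integral>\<^sup>+w. Z w \<partial>PM N)" .
    qed auto
    also have "\<dots> = (ennreal 1 + ennreal (1 / \<kappa>) * (ennreal (real CARD('j)) * ennreal 8)) * (\<integral>\<^sup>+w. Z w \<partial>PM N)"
      by (simp add: distrib_right mult.assoc ennreal_of_nat_eq_real_of_nat)
    also have "ennreal 1 + ennreal (1 / \<kappa>) * (ennreal (real CARD('j)) * ennreal 8) = ennreal (1 + 8 * real CARD('j) / \<kappa>)"
    proof -
      have "ennreal (1 / \<kappa>) * (ennreal (real CARD('j)) * ennreal 8) = ennreal (8 * real CARD('j) / \<kappa>)"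
        using \<kappa> by (subst ennreal_mult[symmetric], simp, simp, subst ennreal_mult[symmetric]) (auto simp: mult.commute)
      then show ?thesis using \<kappa> by (simp only:) (subst ennreal_plus, auto)
    qed
    finally show "(\<integral>\<^sup>+z. G z \<partial>\<Omega> N) \<le> ennreal (1 + 8 * real CARD('j) / \<kappa>) * (\<integral>\<^sup>+w. Z w \<partial>PM N)" .
  next
    fix w S and y :: "'x \<times> 'u \<Rightarrow> real"
    assume z: "(w, S) \<in> space (\<Omega> N)" "valid N (w, S)" "sampled_enough N \<kappa> (w, S)"
      and y: "integrable Q y" "(\<integral>x. y x \<partial>Q) = 0"
      and le: "\<And>w. w \<in> space (PM N) \<Longrightarrow> ennreal \<bar>\<Sum>i<N. y (w i)\<bar> \<le> Z w"
    have w: "w \<in> space (PM N)" using z by (simp add: space_joint_law)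
    have D: "ennreal \<bar>\<Sum>i<N. sg B i * y (w i)\<bar> \<le> D B w" if B: "B \<subseteq> ?I" for B
    proof -
      have "(\<Sum>i<N. sg B i * y (w i)) = (\<Sum>i\<in>?I - B. sg B i * y (w i)) + (\<Sum>i\<in>B. sg B i * y (w i))"
        by (rule sum.subset_diff[OF B finite_lessThan])
      also have "\<dots> = (\<Sum>i\<in>B. y (w i)) - (\<Sum>i\<in>?I - B. y (w i))"
        by (simp add: sg_def sum_negf)
      finally have "ennreal \<bar>\<Sum>i<N. sg B i * y (w i)\<bar> \<le> ennreal (\<bar>\<Sum>i\<in>B. y (w i)\<bar> + \<bar>\<Sum>i\<in>?I - B. y (w i)\<bar>)"
        by (intro ennreal_leI) linarith
      also have "\<dots> = ennreal \<bar>\<Sum>i\<in>B. y (w i)\<bar> + ennreal \<bar>\<Sum>i\<in>?I - B. y (w i)\<bar>"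
        by (rule ennreal_plus) auto
      also have "\<dots> \<le> D B w"
        unfolding D_def
        by (intro add_mono abs_partial_sum_le_subset_majorant[OF prob_Q finite_lessThan _ Z y le w])
          (use B in auto)
      finally show ?thesis .
    qed
    let ?e = "weighted_sum N (w, S) (\<lambda>i. y (w i)) - (\<Sum>i<N. y (w i))"
    have "ennreal \<bar>weighted_sum N (w, S) (\<lambda>i. y (w i))\<bar> \<le> ennreal (\<bar>\<Sum>i<N. y (w i)\<bar> + \<bar>?e\<bar>)"
      by (intro ennreal_leI) linarith
    also have "\<dots> = ennreal \<bar>\<Sum>i<N. y (w i)\<bar> + ennreal \<bar>?e\<bar>" by (rule ennreal_plus) auto
    also have "\<dots> \<le> G (w, S)"
      unfolding G_def fst_conv
      by (intro add_mono le[OF w] weighted_sum_error_le[where D = D and w = w and y = "\<lambda>i. y (w i)", OF z(2,3) \<kappa> D])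
    finally show "ennreal \<bar>weighted_sum N (w, S) (\<lambda>i. y (w i))\<bar> \<le> G (w, S)" .
  qed
qed

text \<open>For constant summands the signed sums do not involve the data and have mean absolute
  value at most sqrt N. So the total weight deviates from N by O(sqrt N) in mean, and Markov's
  inequality at level N/2 gives the rate 1 / sqrt N.\<close>

lemma total_weight_event:
  assumes \<kappa>: "0 < \<kappa>" and N: "1 \<le> N"
  obtains E where "E \<in> sets (\<Omega> N)" "emeasure (\<Omega> N) E \<le> ennreal (8 * real CARD('j) / \<kappa> / sqrt N)"
    "\<And>z. \<lbrakk>z \<in> space (\<Omega> N) - E; valid N z; sampled_enough N \<kappa> z\<rbrakk> \<Longrightarrow> real N / 2 \<le> weighted_sum N z (\<lambda>_. 1)"
proof -
  interpret prob_space "\<Omega> N" by (rule prob_space_joint)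
  interpret P: prob_space "PM N" by (intro prob_space_PiM prob_Q)
  let ?I = "{..<N}"
  define D where "D B w = ennreal \<bar>\<Sum>i<N. sg B i\<bar>" for B and w :: "nat \<Rightarrow> 'x \<times> 'u"
  have Dm: "D B \<in> borel_measurable (PM N)" for B unfolding D_def by simp
  define G where "G z = ennreal (1 / \<kappa>) * (\<Sum>j\<in>UNIV. design_majorant N j D z)" for z
  have Gd: "design_majorant N j D \<in> borel_measurable (\<Omega> N)" for j
    using measurable_design_majorant[OF Dm] by (simp add: measurable_cong_sets[OF sets_joint_law refl])
  have Gm: "G \<in> borel_measurable (\<Omega> N)"
    unfolding G_def using Gd by measurable
  have "(\<integral>\<^sup>+z. G z \<partial>\<Omega> N) = ennreal (1 / \<kappa>) * (\<Sum>j\<in>UNIV. \<integral>\<^sup>+z. design_majorant N j D z \<partial>\<Omega> N)"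
    unfolding G_def using Gd by (simp add: nn_integral_cmult nn_integral_sum)
  also have "\<dots> \<le> ennreal (1 / \<kappa>) * (\<Sum>j\<in>(UNIV::'j set). ennreal (4 * sqrt N))"
  proof (intro mult_left_mono sum_mono)
    fix j
    have "(\<integral>\<^sup>+z. design_majorant N j D z \<partial>\<Omega> N)
        \<le> ennreal (4 / 2 ^ N) * (\<Sum>B\<in>Pow ?I. \<integral>\<^sup>+w. D B w \<partial>PM N)"
      by (rule nn_integral_design_majorant_le[OF Dm])
    also have "(\<Sum>B\<in>Pow ?I. \<integral>\<^sup>+w. D B w \<partial>PM N) = ennreal (\<Sum>B\<in>Pow ?I. \<bar>\<Sum>i<N. sg B i\<bar>)"
      by (simp add: D_def P.emeasure_space_1 sum_ennreal)
    also have "ennreal (4 / 2 ^ N) * \<dots> = ennreal (4 / 2 ^ N * (\<Sum>B\<in>Pow ?I. \<bar>\<Sum>i<N. sg B i\<bar>))"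
      by (rule ennreal_mult[symmetric]) (auto intro: sum_nonneg)
    also have "\<dots> \<le> ennreal (4 / 2 ^ N * (sqrt N * 2 ^ N))"
    proof (intro ennreal_leI mult_left_mono)
      show "(\<Sum>B\<in>Pow ?I. \<bar>\<Sum>i<N. sg B i\<bar>) \<le> sqrt N * 2 ^ N"
        using sum_Pow_abs_sum_sg_le[of ?I] by (simp only: card_lessThan finite_lessThan simp_thms)
    qed simp
    finally show "(\<integral>\<^sup>+z. design_majorant N j D z \<partial>\<Omega> N) \<le> ennreal (4 * sqrt N)" by simp
  qed auto
  also have "\<dots> = ennreal (4 * real CARD('j) / \<kappa> * sqrt N)"
  proof -
    have "(\<Sum>j\<in>(UNIV::'j set). ennreal (4 * sqrt N)) = ennreal (real CARD('j) * (4 * sqrt N))"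
      by (subst ennreal_mult) (auto simp: ennreal_of_nat_eq_real_of_nat)
    then show ?thesis using \<kappa> by (simp only:) (subst ennreal_mult[symmetric], auto simp: mult_ac)
  qed
  finally have Gi: "(\<integral>\<^sup>+z. G z \<partial>\<Omega> N) \<le> ennreal (4 * real CARD('j) / \<kappa> * sqrt N)" .
  obtain E where E: "E \<in> sets (\<Omega> N)" "emeasure (\<Omega> N) E \<le> ennreal (4 * real CARD('j) / \<kappa> * sqrt N / (N / 2))"
      "\<And>z. z \<in> space (\<Omega> N) - E \<Longrightarrow> G z < ennreal (N / 2)"
    by (rule markov_event[OF Gm Gi, of "N / 2"]) (use N \<kappa> in auto)
  show thesis
  proof (rule that[OF E(1)])
    have "4 * a / \<kappa> * sqrt N / (N / 2) = 8 * a / \<kappa> / sqrt N" for a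
      using N \<kappa> by (simp add: field_simps)
    then have "4 * real CARD('j) / \<kappa> * sqrt N / (N / 2) = 8 * real CARD('j) / \<kappa> / sqrt N" .
    then show "emeasure (\<Omega> N) E \<le> ennreal (8 * real CARD('j) / \<kappa> / sqrt N)" using E(2) by simp
    fix z assume z: "z \<in> space (\<Omega> N) - E" "valid N z" "sampled_enough N \<kappa> z"
    obtain w S where wS: "z = (w, S)" by (cases z)
    have "ennreal \<bar>weighted_sum N (w, S) (\<lambda>_. 1) - (\<Sum>i<N. 1)\<bar> \<le> G z"
      unfolding G_def wS by (rule weighted_sum_error_le[OF z(2,3)[unfolded wS] \<kappa>]) (simp add: D_def)
    also have "\<dots> < ennreal (N / 2)" by (rule E(3)[OF z(1)])
    finally have "\<bar>weighted_sum N (w, S) (\<lambda>_. 1) - real N\<bar> < real N / 2" by (simp add: ennreal_less_iff)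
    then show "real N / 2 \<le> weighted_sum N z (\<lambda>_. 1)" unfolding wS by linarith
  qed
qed

text \<open>The factor sqrt N turns the empirical process back into a centered sum. The bound on the
  outer expectation is strict because it is an infimum: strictness supplies an actual majorant with
  integral below \<open>b\<close>.\<close>

lemma localized_event:
  fixes f :: "'i \<Rightarrow> 'x \<Rightarrow> real"
  defines "P0 \<equiv> distr Q MX fst"
  assumes \<kappa>: "0 < \<kappa>" and N: "1 \<le> N" and b: "0 \<le> b" and t: "0 < t"
    and int: "\<And>i. i \<in> A \<Longrightarrow> integrable P0 (f i)"
    and oe: "outer_expectation (\<Omega> N) (\<lambda>(w, S). \<Squnion>i\<in>A. ennreal \<bar>emp_process P0 N w (f i)\<bar>) < ennreal b"
  obtains E where "E \<in> sets (\<Omega> N)"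
    "emeasure (\<Omega> N) E \<le> ennreal ((1 + 8 * real CARD('j) / \<kappa>) * (sqrt N * b) / t)"
    "\<And>w S i. \<lbrakk>(w, S) \<in> space (\<Omega> N) - E; valid N (w, S); sampled_enough N \<kappa> (w, S); i \<in> A\<rbrakk>
      \<Longrightarrow> weighted_sum N (w, S) (\<lambda>k. f i (fst (w k)) - (\<integral>x. f i x \<partial>P0)) < t"
proof -
  interpret prob_space "\<Omega> N" by (rule prob_space_joint)
  interpret Q: prob_space Q by (rule prob_Q)
  obtain Z where Z: "Z \<in> borel_measurable (PM N)" "(\<integral>\<^sup>+w. Z w \<partial>PM N) \<le> ennreal b"
    "\<And>w. w \<in> space (PM N) \<Longrightarrow> (\<Squnion>i\<in>A. ennreal \<bar>emp_process P0 N w (f i)\<bar>) \<le> Z w"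
    using outer_expectation_majorant[OF oe] by blast
  define Y where "Y w = ennreal (sqrt N) * Z w" for w
  have Ym: "Y \<in> borel_measurable (PM N)" unfolding Y_def using Z(1) by measurable
  obtain G where G: "G \<in> borel_measurable (\<Omega> N)"
    "(\<integral>\<^sup>+z. G z \<partial>\<Omega> N) \<le> ennreal (1 + 8 * real CARD('j) / \<kappa>) * (\<integral>\<^sup>+w. Y w \<partial>PM N)"
    "\<And>w S y. \<lbrakk>(w, S) \<in> space (\<Omega> N); valid N (w, S); sampled_enough N \<kappa> (w, S);
        integrable Q y; (\<integral>x. y x \<partial>Q) = 0;
        \<And>w. w \<in> space (PM N) \<Longrightarrow> ennreal \<bar>\<Sum>i<N. y (w i)\<bar> \<le> Y w\<rbrakk>
      \<Longrightarrow> ennreal \<bar>weighted_sum N (w, S) (\<lambda>i. y (w i))\<bar> \<le> G (w, S)"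
    by (rule weighted_sum_majorant[OF \<kappa> Ym]) blast
  have "(\<integral>\<^sup>+w. Y w \<partial>PM N) = ennreal (sqrt N) * (\<integral>\<^sup>+w. Z w \<partial>PM N)"
    unfolding Y_def using Z(1) by (rule nn_integral_cmult)
  also have "\<dots> \<le> ennreal (sqrt N) * ennreal b" by (intro mult_left_mono Z) simp
  also have "\<dots> = ennreal (sqrt N * b)" using b by (simp add: ennreal_mult)
  finally have "(\<integral>\<^sup>+z. G z \<partial>\<Omega> N) \<le> ennreal (1 + 8 * real CARD('j) / \<kappa>) * ennreal (sqrt N * b)"
    using G(2) by (meson mult_left_mono order_trans zero_le)
  then have Gi: "(\<integral>\<^sup>+z. G z \<partial>\<Omega> N) \<le> ennreal ((1 + 8 * real CARD('j) / \<kappa>) * (sqrt N * b))"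
    using \<kappa> b by (subst ennreal_mult) auto
  obtain E where E: "E \<in> sets (\<Omega> N)"
      "emeasure (\<Omega> N) E \<le> ennreal ((1 + 8 * real CARD('j) / \<kappa>) * (sqrt N * b) / t)"
      "\<And>z. z \<in> space (\<Omega> N) - E \<Longrightarrow> G z < ennreal t"
    by (rule markov_event[OF G(1) Gi t]) (use \<kappa> b in auto)
  show thesis
  proof (rule that[OF E(1,2)])
    fix w S i
    assume z: "(w, S) \<in> space (\<Omega> N) - E" "valid N (w, S)" "sampled_enough N \<kappa> (w, S)" and i: "i \<in> A"
    define y where "y x = f i (fst x) - (\<integral>x. f i x \<partial>P0)" for x :: "'x \<times> 'u"
    have fst: "fst \<in> measurable Q MX"
      by (subst measurable_cong_sets[OF sets_Q refl]) simp
    have fm: "f i \<in> borel_measurable MX" using int[OF i] unfolding P0_def by (simp add: integrable_iff_bounded)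
    have fi: "integrable Q (\<lambda>x. f i (fst x))"
      using int[OF i] unfolding P0_def by (subst (asm) integrable_distr_eq[OF fst fm])
    have fe: "(\<integral>x. f i x \<partial>P0) = (\<integral>x. f i (fst x) \<partial>Q)"
      unfolding P0_def by (rule integral_distr[OF fst fm])
    have yi: "integrable Q y" unfolding y_def using fi by simp
    have y0: "(\<integral>x. y x \<partial>Q) = 0" unfolding y_def fe using fi by (simp add: Q.prob_space)
    have yle: "ennreal \<bar>\<Sum>k<N. y (v k)\<bar> \<le> Y v" if v: "v \<in> space (PM N)" for v
    proof -
      have "sqrt N * emp_process P0 N v (f i) = (sqrt N * sqrt N) * (1 / N * (\<Sum>k<N. f i (fst (v k))) - (\<integral>x. f i x \<partial>P0))"
        by (simp add: emp_process_def)
      also have "\<dots> = (\<Sum>k<N. y (v k))"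
        using N by (simp add: y_def sum_subtractf field_simps)
      finally have eq: "sqrt N * emp_process P0 N v (f i) = (\<Sum>k<N. y (v k))" .
      have "ennreal \<bar>\<Sum>k<N. y (v k)\<bar> = ennreal (sqrt N) * ennreal \<bar>emp_process P0 N v (f i)\<bar>"
        unfolding eq[symmetric] by (simp add: abs_mult ennreal_mult)
      also have "\<dots> \<le> Y v"
        unfolding Y_def by (intro mult_left_mono order_trans[OF _ Z(3)[OF v]] SUP_upper i) simp
      finally show ?thesis .
    qed
    have "ennreal \<bar>weighted_sum N (w, S) (\<lambda>i. y (w i))\<bar> \<le> G (w, S)"
      using z by (intro G(3) yi y0 yle) auto
    also have "\<dots> < ennreal t" using E(3) z by blast
    finally have "\<bar>weighted_sum N (w, S) (\<lambda>i. y (w i))\<bar> < t" by (simp add: ennreal_less_iff)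
    then show "weighted_sum N (w, S) (\<lambda>k. f i (fst (w k)) - (\<integral>x. f i x \<partial>P0)) < t"
      by (simp add: y_def)
  qed
qed

text \<open>Recentering by an arbitrary \<open>c\<close>, later P_0 (f - g). Because the weights
  need not sum to N, \<open>c\<close> comes back multiplied by the total weight.\<close>

lemma H_emp_diff_eq:
  "H_emp h \<V> n \<rho> N (w, S) f - H_emp h \<V> n \<rho> N (w, S) g =
    1 / real N * (weighted_sum N (w, S) (\<lambda>k. (f (fst (w k)) - g (fst (w k))) - c) + c * weighted_sum N (w, S) (\<lambda>_. 1))"
proof -
  have "weighted_sum N (w, S) (\<lambda>k. (f (fst (w k)) - g (fst (w k))) - c) + c * weighted_sum N (w, S) (\<lambda>_. 1)
    = weighted_sum N (w, S) (\<lambda>k. f (fst (w k))) - weighted_sum N (w, S) (\<lambda>k. g (fst (w k)))"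
    unfolding weighted_sum_def prod.case sum_distrib_left sum_subtractf[symmetric] sum.distrib[symmetric]
    by (intro sum.cong refl) (simp add: algebra_simps diff_divide_distrib add_divide_distrib)
  then show ?thesis
    by (simp add: H_emp_def weighted_sum_def right_diff_distrib)
qed

section \<open>Peeling\<close>

text \<open>A union of one event per shell 2^s < r * norm (\<theta> - \<theta>0) \<le> 2^(s+1), s
  \<ge> M. The event is independent of \<theta> and of the slack \<open>K\<close>, so both may later
  be random: the estimator and the error in its near-maximality.\<close>

lemma peeling_event:
  fixes m :: "'b::real_normed_vector \<Rightarrow> 'x \<Rightarrow> real" and \<phi> :: "real \<Rightarrow> real"
  defines "P0 \<equiv> distr Q MX fst"
  assumes \<kappa>: "0 < \<kappa>" and N: "1 \<le> N" and r: "0 < r" and K1: "0 < K1" and K2: "0 < K2"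
    and curv: "\<And>\<theta>. \<lbrakk>\<theta> \<in> \<Theta>; norm (\<theta> - \<theta>0) < \<delta>\<rbrakk> \<Longrightarrow> integrable P0 (\<lambda>x. m \<theta> x - m \<theta>0 x) \<and>
           (\<integral>x. (m \<theta> x - m \<theta>0 x) \<partial>P0) \<le> - (K1 * (norm (\<theta> - \<theta>0))\<^sup>2)"
    and maximal: "\<And>d. \<lbrakk>0 < d; d < \<delta>\<rbrakk> \<Longrightarrow> outer_expectation (\<Omega> N) (\<lambda>(w, S).
             \<Squnion>\<theta> \<in> {\<theta> \<in> \<Theta>. norm (\<theta> - \<theta>0) < d}.
               ennreal \<bar>emp_process P0 N w (\<lambda>x. m \<theta> x - m \<theta>0 x)\<bar>) \<le> ennreal (K2 * \<phi> d)"
    and \<alpha>: "\<alpha> < 2" and mono: "antimono_on {0<..} (\<lambda>\<delta>. \<phi> \<delta> / \<delta> powr \<alpha>)"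
    and rate: "r\<^sup>2 * \<phi> (1 / r) \<le> sqrt (real N)"
  obtains E where "E \<in> sets (\<Omega> N)"
    "emeasure (\<Omega> N) E \<le> ennreal ((1 + 8 * real CARD('j) / \<kappa>) * (8 * K2 / K1 * 4 powr \<alpha>)
       / (1 - 2 powr (\<alpha> - 2)) * (2 powr (\<alpha> - 2)) ^ M)"
    "\<And>w S \<theta> K. \<lbrakk>(w, S) \<in> space (\<Omega> N) - E; valid N (w, S); sampled_enough N \<kappa> (w, S);
        real N / 2 \<le> weighted_sum N (w, S) (\<lambda>_. 1); \<theta> \<in> \<Theta>; 4 * norm (\<theta> - \<theta>0) < \<delta>; K \<le> K1 / 4 * 4 ^ M;
        H_emp h \<V> n \<rho> N (w, S) (m \<theta>0) - K / r\<^sup>2 \<le> H_emp h \<V> n \<rho> N (w, S) (m \<theta>)\<rbrakk>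
      \<Longrightarrow> r * norm (\<theta> - \<theta>0) \<le> 2 ^ M"
proof -
  define q where "q = 2 powr (\<alpha> - 2)"
  have q: "0 < q" "q < 1" using \<alpha> by (auto simp: q_def powr_less_one)
  define C where "C = 1 + 8 * real CARD('j) / \<kappa>"
  have C: "0 < C" using \<kappa> by (simp add: C_def add_pos_nonneg)
  define c where "c = C * (8 * K2 / K1 * 4 powr \<alpha>)"
  have c: "0 < c" using C K1 K2 by (simp add: c_def)
  \<comment> \<open>Twice the outer radius of shell s, which turns the weak upper end of the shell
    into a strict inequality. It is also 4 times the inner radius, whence the requirement
    \<open>4 * norm (\<theta> - \<theta>0) < \<delta>\<close>.\<close>
  define d where "d s = 2 ^ (s + 2) / r" for s :: nat
  \<comment> \<open>Half of the curvature survives the weighting, N K1 / 2 * 4^s / r^2; the slack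
    uses at most half of that, and the remaining N K1 / 4 * 4^s / r^2 must come from
    fluctuation.\<close>
  define t where "t s = real N * (K1 / 4 * 4 ^ s / r\<^sup>2)" for s :: nat
  define \<A> where "\<A> s = {\<theta> \<in> \<Theta>. norm (\<theta> - \<theta>0) < d s}" for s
  have t: "0 < t s" for s using N K1 r by (simp add: t_def)
  define good where "good s E \<longleftrightarrow> E \<in> sets (\<Omega> N) \<and> emeasure (\<Omega> N) E \<le> ennreal (c * q ^ s) \<and>
     (d s < \<delta> \<longrightarrow> (\<forall>w S \<theta>. (w, S) \<in> space (\<Omega> N) - E \<longrightarrow> valid N (w, S) \<longrightarrow> sampled_enough N \<kappa> (w, S) \<longrightarrow> \<theta> \<in> \<A> s \<longrightarrow>
        weighted_sum N (w, S) (\<lambda>k. (m \<theta> (fst (w k)) - m \<theta>0 (fst (w k))) - (\<integral>x. m \<theta> x - m \<theta>0 x \<partial>P0)) < t s))"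
    for s E
  have ex: "\<exists>E. good s E" for s
  proof (cases "d s < \<delta>")
    case False
    then show ?thesis unfolding good_def by (intro exI[of _ "{}"]) simp
  next
    case True
    \<comment> \<open>The leading 2 only serves to make the bound on the outer expectation
      strict.\<close>
    define b where "b = 2 * (K2 * ((2 ^ (s + 2)) powr \<alpha> * (sqrt N / r\<^sup>2)))"
    have d: "0 < d s" using r by (simp add: d_def)
    \<comment> \<open>Monotonicity of \<phi>(\<delta>) / \<delta>^\<alpha> compares radius
      \<open>d s\<close> with radius 1/r, the only one at which the rate condition speaks.\<close>
    have "1 / r \<le> d s" using r one_le_power[of "2::real" "s + 2"] unfolding d_def by (intro divide_right_mono) auto
    then have "\<phi> (d s) / d s powr \<alpha> \<le> \<phi> (1 / r) / (1 / r) powr \<alpha>"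
      using d r by (intro monotone_onD[OF mono]) auto
    then have "\<phi> (d s) \<le> d s powr \<alpha> / (1 / r) powr \<alpha> * \<phi> (1 / r)"
      using d by (simp add: field_simps)
    also have "d s powr \<alpha> / (1 / r) powr \<alpha> = (2 ^ (s + 2)) powr \<alpha>"
      using d r by (subst powr_divide[symmetric]) (auto simp: d_def)
    also have "(2 ^ (s + 2)) powr \<alpha> * \<phi> (1 / r) \<le> (2 ^ (s + 2)) powr \<alpha> * (sqrt N / r\<^sup>2)"
      using rate r by (intro mult_left_mono) (auto simp: field_simps)
    finally have "K2 * \<phi> (d s) \<le> K2 * ((2 ^ (s + 2)) powr \<alpha> * (sqrt N / r\<^sup>2))"
      using K2 by (intro mult_left_mono) auto
    moreover have pos: "0 < K2 * ((2 ^ (s + 2)) powr \<alpha> * (sqrt N / r\<^sup>2))"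
      using K2 N r by simp
    ultimately have "K2 * \<phi> (d s) < b" "0 < b" unfolding b_def by linarith+
    then have "ennreal (K2 * \<phi> (d s)) < ennreal b" by (simp add: ennreal_lessI)
    then have oe: "outer_expectation (\<Omega> N) (\<lambda>(w, S). \<Squnion>\<theta>\<in>\<A> s.
        ennreal \<bar>emp_process P0 N w (\<lambda>x. m \<theta> x - m \<theta>0 x)\<bar>) < ennreal b"
      using maximal[OF d True] unfolding \<A>_def by (rule order_le_less_trans[rotated])
    have int: "integrable P0 (\<lambda>x. m \<theta> x - m \<theta>0 x)" if "\<theta> \<in> \<A> s" for \<theta>
      using curv[of \<theta>] that True by (auto simp: \<A>_def)
    obtain E where E: "E \<in> sets (\<Omega> N)" "emeasure (\<Omega> N) E \<le> ennreal (C * (sqrt N * b) / t s)"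
      "\<And>w S \<theta>. \<lbrakk>(w, S) \<in> space (\<Omega> N) - E; valid N (w, S); sampled_enough N \<kappa> (w, S); \<theta> \<in> \<A> s\<rbrakk>
        \<Longrightarrow> weighted_sum N (w, S) (\<lambda>k. (m \<theta> (fst (w k)) - m \<theta>0 (fst (w k))) - (\<integral>x. m \<theta> x - m \<theta>0 x \<partial>P0)) < t s"
      unfolding C_def P0_def
      by (rule localized_event[OF \<kappa> N less_imp_le[OF \<open>0 < b\<close>] t[of s] int[unfolded P0_def] oe[unfolded P0_def]]) blast+
    have "(2 ^ (s + 2)) powr \<alpha> = 4 powr \<alpha> * (2 powr \<alpha>) ^ s"
    proof -
      have "(2 ^ (s + 2)) powr \<alpha> = (4 * 2 ^ s) powr \<alpha>" by (simp add: mult.commute)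
      also have "\<dots> = 4 powr \<alpha> * (2 ^ s) powr \<alpha>" by (rule powr_mult)
      also have "(2 ^ s) powr \<alpha> = (2 powr \<alpha>) ^ s"
        by (simp add: powr_powr mult.commute flip: powr_realpow)
      finally show ?thesis .
    qed
    moreover have "q ^ s = (2 powr \<alpha>) ^ s / 4 ^ s"
      unfolding q_def by (simp add: powr_diff power_divide)
    moreover have "sqrt N * sqrt N = real N" by simp
    ultimately have "C * (sqrt N * b) / t s = c * q ^ s"
      unfolding b_def t_def c_def using N K1 r by (simp add: field_simps)
    then show ?thesis using E unfolding good_def by (intro exI[of _ E]) simp
  qed
  define E where "E s = (SOME E. good s E)" for s
  have good: "good s (E s)" for s
    unfolding E_def by (rule someI_ex[OF ex])
  have E: "E s \<in> sets (\<Omega> N)" "emeasure (\<Omega> N) (E s) \<le> ennreal (c * q ^ s)" for s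
    using good[of s] unfolding good_def by blast+
  have E_bound: "weighted_sum N (w, S) (\<lambda>k. (m \<theta> (fst (w k)) - m \<theta>0 (fst (w k))) - (\<integral>x. m \<theta> x - m \<theta>0 x \<partial>P0)) < t s"
    if "d s < \<delta>" "(w, S) \<in> space (\<Omega> N) - E s" "valid N (w, S)" "sampled_enough N \<kappa> (w, S)" "\<theta> \<in> \<A> s" for s w S \<theta>
    using good[of s] that unfolding good_def by blast
  show thesis
  proof (rule that)
    show "(\<Union>s. E (M + s)) \<in> sets (\<Omega> N)" using E(1) by auto
    have "emeasure (\<Omega> N) (\<Union>s. E (M + s)) \<le> (\<Sum>s. emeasure (\<Omega> N) (E (M + s)))"
      using E(1) by (intro emeasure_subadditive_countably) auto
    also have "\<dots> \<le> (\<Sum>s. ennreal (c * q ^ (M + s)))"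
      using E(2) by (intro suminf_le) auto
    also have "\<dots> = ennreal (\<Sum>s. c * q ^ (M + s))"
      using q c by (intro suminf_ennreal2) (auto intro!: summable_mult simp: power_add)
    \<comment> \<open>Geometric tail with ratio 2^(\<alpha> - 2): mean 2^(\<alpha> s) against
      threshold 4^s.\<close>
    also have "(\<Sum>s. c * q ^ (M + s)) = c / (1 - q) * q ^ M"
    proof -
      have "(\<lambda>s. c * q ^ M * q ^ s) sums (c * q ^ M * (1 / (1 - q)))"
        using q by (intro sums_mult geometric_sums) auto
      then show ?thesis by (simp add: sums_iff power_add mult.assoc)
    qed
    finally show "emeasure (\<Omega> N) (\<Union>s. E (M + s)) \<le> ennreal ((1 + 8 * real CARD('j) / \<kappa>) * (8 * K2 / K1 * 4 powr \<alpha>)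
       / (1 - 2 powr (\<alpha> - 2)) * (2 powr (\<alpha> - 2)) ^ M)"
      unfolding c_def C_def q_def .
  next
    fix w S \<theta> K
    assume z: "(w, S) \<in> space (\<Omega> N) - (\<Union>s. E (M + s))" "valid N (w, S)" "sampled_enough N \<kappa> (w, S)"
      and W: "real N / 2 \<le> weighted_sum N (w, S) (\<lambda>_. 1)"
      and \<theta>: "\<theta> \<in> \<Theta>" "4 * norm (\<theta> - \<theta>0) < \<delta>" and K: "K \<le> K1 / 4 * 4 ^ M"
      and H: "H_emp h \<V> n \<rho> N (w, S) (m \<theta>0) - K / r\<^sup>2 \<le> H_emp h \<V> n \<rho> N (w, S) (m \<theta>)"
    let ?x = "norm (\<theta> - \<theta>0)" and ?W = "weighted_sum N (w, S) (\<lambda>_. 1)" and ?c = "\<integral>x. m \<theta> x - m \<theta>0 x \<partial>P0"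
    let ?Y = "weighted_sum N (w, S) (\<lambda>k. (m \<theta> (fst (w k)) - m \<theta>0 (fst (w k))) - ?c)"
    show "r * norm (\<theta> - \<theta>0) \<le> 2 ^ M"
    proof (rule ccontr)
      assume "\<not> r * ?x \<le> 2 ^ M"
      then have "2 ^ M < r * ?x" by simp
      then obtain s where s: "M \<le> s" "2 ^ s < r * ?x" "r * ?x \<le> 2 ^ Suc s"
        by (rule dyadic_bracket)
      have "d s < 4 * ?x" using s(2) r by (simp add: d_def field_simps)
      then have "d s < \<delta>" using \<theta> by linarith
      have "r * ?x < 2 ^ (s + 2)" using s(3) power_strict_increasing[of "Suc s" "s + 2" "2::real"] by linarith
      then have \<A>: "\<theta> \<in> \<A> s" using \<theta> r by (simp add: \<A>_def d_def field_simps)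
      have "(w, S) \<in> space (\<Omega> N) - E (M + (s - M))"
        using z(1) by blast
      then have "(w, S) \<in> space (\<Omega> N) - E s" using s(1) by simp
      then have Y: "?Y < t s" by (rule E_bound[OF \<open>d s < \<delta>\<close> _ z(2,3) \<A>])
      have "?x < \<delta>" using \<theta>(2) norm_ge_zero[of "\<theta> - \<theta>0"] by linarith
      then have c: "?c \<le> - (K1 * ?x\<^sup>2)" using curv[OF \<theta>(1)] by blast
      have "(4::real) ^ s = (2\<^sup>2) ^ s" by simp
      also have "\<dots> = (2 ^ s)\<^sup>2" by (simp only: power_mult[symmetric] mult.commute)
      also have "\<dots> \<le> (r * ?x)\<^sup>2" using s(2) by (intro power_mono) auto
      finally have x2: "4 ^ s / r\<^sup>2 \<le> ?x\<^sup>2" using r by (simp add: field_simps power_mult_distrib)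
      have "- K / r\<^sup>2 \<le> 1 / real N * (?Y + ?c * ?W)"
        using H H_emp_diff_eq[of N w S "m \<theta>" "m \<theta>0" ?c] by simp
      then have "real N * (- K / r\<^sup>2) \<le> ?Y + ?c * ?W"
        using N by (simp add: field_simps)
      moreover have "?c * ?W \<le> - (K1 * ?x\<^sup>2) * (real N / 2)"
      proof -
        have "?c * ?W \<le> - (K1 * ?x\<^sup>2) * ?W" using c W by (intro mult_right_mono) auto
        also have "\<dots> \<le> - (K1 * ?x\<^sup>2) * (real N / 2)" using K1 W by (intro mult_left_mono_neg) auto
        finally show ?thesis .
      qed
      moreover have "- (K1 * ?x\<^sup>2) * (real N / 2) \<le> - (K1 * (4 ^ s / r\<^sup>2) * (real N / 2))"
      proof -
        have "K1 * (4 ^ s / r\<^sup>2) \<le> K1 * ?x\<^sup>2" using x2 K1 by (intro mult_left_mono) auto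
        then have "K1 * (4 ^ s / r\<^sup>2) * (real N / 2) \<le> K1 * ?x\<^sup>2 * (real N / 2)"
          by (rule mult_right_mono) simp
        then show ?thesis by (simp only: mult_minus_left neg_le_iff_le)
      qed
      moreover have "real N * (- (K1 / 4 * 4 ^ s) / r\<^sup>2) \<le> real N * (- K / r\<^sup>2)"
      proof (intro mult_left_mono divide_right_mono)
        have "K1 / 4 * 4 ^ M \<le> K1 / 4 * 4 ^ s" using s(1) K1 by (intro mult_left_mono power_increasing) auto
        then show "- (K1 / 4 * 4 ^ s) \<le> - K" using K by linarith
      qed auto
      moreover have "p + b \<le> y" if "p' \<le> y + e" "e \<le> e'" "e' \<le> - b" "p \<le> p'" for p p' b y e e' :: real
        using that by linarith
      ultimately have "real N * (- (K1 / 4 * 4 ^ s) / r\<^sup>2) + (K1 * (4 ^ s / r\<^sup>2)) * (real N / 2) \<le> ?Y" by blast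
      moreover have "real N * (- (K1 / 4 * 4 ^ s) / r\<^sup>2) + (K1 * (4 ^ s / r\<^sup>2)) * (real N / 2) = t s"
        by (simp add: t_def field_simps)
      ultimately show False using Y by simp
    qed
  qed
qed

text \<open>Convergence is assumed at each fixed point only, but inside source \<open>j\<close> the
  selection probability is the same at every point, so one representative per nonempty source
  suffices. A fraction below c/2 is then more than c/2 away from \<open>p j \<ge> c\<close>.\<close>

lemma undersampled_tendsto_0:
  assumes lim: "\<And>j v. v \<in> (\<Union>k. \<V> k) \<Longrightarrow>
           tendsto_outer_prob \<Omega> (\<lambda>N (w, S). sel_prob h \<V> n N w j v) (p j * indicator (\<V> j) v)"
    and c: "0 < c" "\<And>j. c \<le> p j"
  shows "(\<lambda>N. outer_measure_of (\<Omega> N) {z \<in> space (\<Omega> N). \<not> sampled_enough N (c / 2) z}) \<longlonglongrightarrow> 0"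
proof -
  define J where "J = {j. \<V> j \<noteq> {}}"
  define v where "v j = (SOME x. x \<in> \<V> j)" for j
  have v: "v j \<in> \<V> j" if "j \<in> J" for j
    using that some_in_eq unfolding J_def v_def by blast
  define B where "B N j = {z \<in> space (\<Omega> N). dist ((\<lambda>(w, S). sel_prob h \<V> n N w j (v j)) z) (p j * indicator (\<V> j) (v j)) > c / 2}" for N j
  have "(\<lambda>N. outer_measure_of (\<Omega> N) (B N j)) \<longlonglongrightarrow> 0" if "j \<in> J" for j
  proof -
    have "v j \<in> (\<Union>k. \<V> k)" using v[OF that] by blast
    from lim[OF this, of j] have "0 < c / 2 \<longrightarrow> (\<lambda>N. outer_measure_of (\<Omega> N) (B N j)) \<longlonglongrightarrow> 0"
      unfolding tendsto_outer_prob_def B_def by (rule spec)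
    then show ?thesis using c(1) by simp
  qed
  then have "(\<lambda>N. \<Sum>j\<in>J. outer_measure_of (\<Omega> N) (B N j)) \<longlonglongrightarrow> (\<Sum>j\<in>J. 0)"
    by (rule tendsto_sum)
  then have lim0: "(\<lambda>N. \<Sum>j\<in>J. outer_measure_of (\<Omega> N) (B N j)) \<longlonglongrightarrow> 0" by simp
  have sub: "{z \<in> space (\<Omega> N). \<not> sampled_enough N (c / 2) z} \<subseteq> (\<Union>j\<in>J. B N j)" for N
  proof
    fix z assume z: "z \<in> {z \<in> space (\<Omega> N). \<not> sampled_enough N (c / 2) z}"
    obtain w S where wS: "z = (w, S)" by (cases z)
    obtain j where j: "units N w j \<noteq> {}" "real (ssize N w j) / real (card (units N w j)) < c / 2"
      using z by (auto simp: wS sampled_enough_def not_le)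
    then have "j \<in> J" by (auto simp: J_def source_units_def)
    have "c / 2 < \<bar>real (ssize N w j) / real (card (units N w j)) - p j\<bar>"
      using j(2) c(2)[of j] by linarith
    then have "z \<in> B N j"
      using z v[OF \<open>j \<in> J\<close>] by (simp add: B_def wS sel_prob_def dist_real_def)
    then show "z \<in> (\<Union>j\<in>J. B N j)" using \<open>j \<in> J\<close> by blast
  qed
  have "outer_measure_of (\<Omega> N) {z \<in> space (\<Omega> N). \<not> sampled_enough N (c / 2) z}
      \<le> (\<Sum>j\<in>J. outer_measure_of (\<Omega> N) (B N j))" for N
    by (rule order_trans[OF outer_measure_of_mono[OF sub] outer_measure_of_UN_le]) simp
  then show ?thesis
    by (intro tendsto_sandwich[OF _ _ tendsto_const lim0]) auto
qed

lemma outer_measure_invalid: "outer_measure_of (\<Omega> N) {z \<in> space (\<Omega> N). \<not> valid N z} = 0"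
proof -
  obtain E where E: "{z \<in> space (\<Omega> N). \<not> valid N z} \<subseteq> E" "E \<in> sets (\<Omega> N)" "emeasure (\<Omega> N) E = 0"
    using AE_valid[of N] by (elim AE_E)
  then show ?thesis
    using outer_measure_of_mono[OF E(1), of "\<Omega> N"] by (simp add: outer_measure_of_eq)
qed

end

section \<open>The rate of convergence: assembling the exceptional events\<close>

theorem theorem5p2:
  fixes MX :: "'x measure" and MC :: "'c measure" and MU :: "'u measure"
    and P :: "'b::banach \<Rightarrow> 'x measure"
    and \<Theta> :: "'b set" and \<theta>0 :: 'b
    and m :: "'b \<Rightarrow> 'x \<Rightarrow> real"
    and Q :: "('x \<times> 'u) measure"
    and h :: "'x \<Rightarrow> 'c"
    and \<V> :: "'j::finite \<Rightarrow> ('c \<times> 'u) set"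
    and n :: "nat \<Rightarrow> 'j \<Rightarrow> nat \<Rightarrow> nat"
    and p :: "'j \<Rightarrow> real"
    and \<rho> :: "'j \<Rightarrow> 'c \<times> 'u \<Rightarrow> real"
    and est :: "nat \<Rightarrow> (nat \<Rightarrow> 'x \<times> 'u) \<times> ('j \<Rightarrow> nat set) \<Rightarrow> 'b"
    and \<phi> :: "nat \<Rightarrow> real \<Rightarrow> real" and \<alpha> :: real
    and r :: "nat \<Rightarrow> real"
  defines "\<Omega> \<equiv> joint_law Q h \<V> n"
    \<comment> \<open>model\<close>
  assumes "\<And>\<theta>. \<theta> \<in> \<Theta> \<Longrightarrow> prob_space (P \<theta>)"
    and "\<And>\<theta>. \<theta> \<in> \<Theta> \<Longrightarrow> sets (P \<theta>) = sets MX"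
    and "\<theta>0 \<in> \<Theta>"
    \<comment> \<open>law of \<open>W = (X, U)\<close>, coarsening and data sources\<close>
    and "prob_space Q"
    and "sets Q = sets (MX \<Otimes>\<^sub>M MU)"
    and "distr Q MX fst = P \<theta>0"
    and "h \<in> measurable MX MC"
    and "\<And>j. \<V> j \<in> sets (MC \<Otimes>\<^sub>M MU)"
    and "AE w in Q. vval h w \<in> (\<Union>j. \<V> j)"
    \<comment> \<open>sampling design\<close>
    and "\<And>N j k. k \<le> N \<Longrightarrow> n N j k \<le> k"
    and "\<And>j v. v \<in> (\<Union>k. \<V> k) \<Longrightarrow>
           tendsto_outer_prob \<Omega> (\<lambda>N (w, S). sel_prob h \<V> n N w j v) (p j * indicator (\<V> j) v)"
    and "\<exists>c>0. \<forall>j. p j \<ge> c"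
    and "weight_function \<V> \<rho>"
    \<comment> \<open>curvature of the criterion at \<open>\<theta>0\<close>\<close>
    and "\<exists>K>0. \<exists>\<eta>>0. \<forall>\<theta>\<in>\<Theta>. norm (\<theta> - \<theta>0) < \<eta> \<longrightarrow>
           integrable (P \<theta>0) (\<lambda>x. m \<theta> x - m \<theta>0 x) \<and>
           (\<integral>x. (m \<theta> x - m \<theta>0 x) \<partial>P \<theta>0) \<le> K * (- (norm (\<theta> - \<theta>0))\<^sup>2)"
    \<comment> \<open>maximal inequality, uniform in \<open>N\<close>\<close>
    and "\<exists>K>0. \<exists>\<delta>0>0. \<forall>N\<ge>1. \<forall>\<delta>. 0 < \<delta> \<and> \<delta> < \<delta>0 \<longrightarrow>
           enn2ereal (outer_expectation (\<Omega> N) (\<lambda>(w, S).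
             \<Squnion>\<theta> \<in> {\<theta> \<in> \<Theta>. norm (\<theta> - \<theta>0) < \<delta>}.
               ennreal \<bar>emp_process (P \<theta>0) N w (\<lambda>x. m \<theta> x - m \<theta>0 x)\<bar>))
           \<le> ereal (K * \<phi> N \<delta>)"
    and "\<alpha> < 2"
    and "\<And>N. N \<ge> 1 \<Longrightarrow> antimono_on {0<..} (\<lambda>\<delta>. \<phi> N \<delta> / \<delta> powr \<alpha>)"
    \<comment> \<open>rate\<close>
    and "\<And>N. N \<ge> 1 \<Longrightarrow> r N > 0"
    and "\<And>N. N \<ge> 1 \<Longrightarrow> (r N)\<^sup>2 * \<phi> N (1 / r N) \<le> sqrt (real N)"
    \<comment> \<open>consistent near-maximizer\<close>
    and "\<And>N \<omega>. \<omega> \<in> space (\<Omega> N) \<Longrightarrow> est N \<omega> \<in> \<Theta>"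
    and "tendsto_outer_prob \<Omega> est \<theta>0"
    and "\<exists>Z. bounded_outer_prob \<Omega> Z \<and>
           (\<forall>N\<ge>1. \<forall>\<omega>\<in>space (\<Omega> N).
              H_emp h \<V> n \<rho> N \<omega> (m (est N \<omega>)) \<ge> H_emp h \<V> n \<rho> N \<omega> (m \<theta>0) - Z N \<omega> / (r N)\<^sup>2)"
  shows "bounded_outer_prob \<Omega> (\<lambda>N \<omega>. r N * norm (est N \<omega> - \<theta>0))"
proof -
  have sampling: "merged_sampling MX MC MU Q h \<V> n \<rho>"
    by (rule merged_sampling.intro) fact+
  interpret merged_sampling MX MC MU Q h \<V> n \<rho> by (rule sampling)
  have P0: "P \<theta>0 = distr Q MX fst" using assms(7) by simp
  obtain c where c: "0 < c" "\<And>j. c \<le> p j" using assms(13) by auto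
  define \<kappa> where "\<kappa> = c / 2"
  have \<kappa>: "0 < \<kappa>" using c by (simp add: \<kappa>_def)
  obtain K1 \<eta> where K1: "0 < K1" "0 < \<eta>"
    and curv: "\<And>\<theta>. \<lbrakk>\<theta> \<in> \<Theta>; norm (\<theta> - \<theta>0) < \<eta>\<rbrakk> \<Longrightarrow> integrable (P \<theta>0) (\<lambda>x. m \<theta> x - m \<theta>0 x) \<and>
           (\<integral>x. (m \<theta> x - m \<theta>0 x) \<partial>P \<theta>0) \<le> K1 * (- (norm (\<theta> - \<theta>0))\<^sup>2)"
    using assms(15) by blast
  obtain K2 \<delta>0 where K2: "0 < K2" "0 < \<delta>0"
    and maximal: "\<And>N \<delta>. \<lbrakk>1 \<le> N; 0 < \<delta>; \<delta> < \<delta>0\<rbrakk> \<Longrightarrow>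
           enn2ereal (outer_expectation (\<Omega> N) (\<lambda>(w, S).
             \<Squnion>\<theta> \<in> {\<theta> \<in> \<Theta>. norm (\<theta> - \<theta>0) < \<delta>}.
               ennreal \<bar>emp_process (P \<theta>0) N w (\<lambda>x. m \<theta> x - m \<theta>0 x)\<bar>))
           \<le> ereal (K2 * \<phi> N \<delta>)"
    using assms(16) by blast
  obtain Z where Z: "bounded_outer_prob \<Omega> Z"
    and near_max: "\<And>N \<omega>. \<lbrakk>1 \<le> N; \<omega> \<in> space (\<Omega> N)\<rbrakk> \<Longrightarrow>
      H_emp h \<V> n \<rho> N \<omega> (m \<theta>0) - Z N \<omega> / (r N)\<^sup>2 \<le> H_emp h \<V> n \<rho> N \<omega> (m (est N \<omega>))"
    using assms(23) by blast
  define \<delta> where "\<delta> = min \<eta> \<delta>0"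
  have \<delta>: "0 < \<delta>" using K1 K2 by (simp add: \<delta>_def)
  define q where "q = 2 powr (\<alpha> - 2)"
  have q: "0 < q" "q < 1" using \<open>\<alpha> < 2\<close> by (auto simp: q_def powr_less_one)
  define C where "C = (1 + 8 * real CARD('j) / \<kappa>) * (8 * K2 / K1 * 4 powr \<alpha>) / (1 - q)"
  show ?thesis
    unfolding bounded_outer_prob_def
  proof (intro allI impI)
    fix \<epsilon> :: real assume \<epsilon>: "0 < \<epsilon>"
    \<comment> \<open>Five exceptional sets share \<epsilon>: too small a total weight, a shell
      event, large slack, an estimator far from \<theta>0, an undersampled source. The sixth,
      invalid configurations, is null.\<close>
    then have e5: "0 < \<epsilon> / 5" by simp
    obtain K where K: "\<forall>\<^sub>F N in sequentially. outer_measure_of (\<Omega> N) {\<omega> \<in> space (\<Omega> N). \<bar>Z N \<omega>\<bar> > K} \<le> ennreal (\<epsilon> / 5)"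
      using Z e5 unfolding bounded_outer_prob_def by blast
    have "(\<lambda>M. C * q ^ M) \<longlonglongrightarrow> C * 0"
      using q by (intro tendsto_mult tendsto_const LIMSEQ_power_zero) auto
    then have "\<forall>\<^sub>F M in sequentially. C * q ^ M < \<epsilon> / 5"
      using e5 by (intro order_tendstoD(2)) auto
    moreover have "\<forall>\<^sub>F M in sequentially. K \<le> K1 / 4 * 4 ^ M"
    proof -
      obtain M0 where "4 * K / K1 < 4 ^ M0" using real_arch_pow[of 4] by auto
      then have "K \<le> K1 / 4 * 4 ^ M" if "M0 \<le> M" for M
      proof -
        have "4 * K / K1 \<le> 4 ^ M"
          using \<open>4 * K / K1 < 4 ^ M0\<close> power_increasing[OF that, of "4::real"] by linarith
        then show ?thesis using K1 by (simp add: field_simps)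
      qed
      then show ?thesis by (auto simp: eventually_sequentially)
    qed
    ultimately have "\<forall>\<^sub>F M in sequentially. C * q ^ M < \<epsilon> / 5 \<and> K \<le> K1 / 4 * 4 ^ M"
      by (rule eventually_conj)
    \<comment> \<open>\<open>M\<close> depends on \<epsilon> but not on \<open>N\<close>, so
      \<open>2 ^ M\<close> can serve as the bound for all large \<open>N\<close>. The second
      condition lets every shell from \<open>M\<close> on absorb the slack.\<close>
    then obtain M where M: "C * q ^ M < \<epsilon> / 5" "K \<le> K1 / 4 * 4 ^ M"
      unfolding eventually_sequentially by blast
    have "(\<lambda>N. outer_measure_of (\<Omega> N) {z \<in> space (\<Omega> N). \<not> sampled_enough N \<kappa> z}) \<longlonglongrightarrow> 0"
      unfolding \<kappa>_def \<Omega>_def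
      by (rule undersampled_tendsto_0[OF assms(12)[unfolded \<Omega>_def] c])
    then have ev_sampled: "\<forall>\<^sub>F N in sequentially. outer_measure_of (\<Omega> N) {z \<in> space (\<Omega> N). \<not> sampled_enough N \<kappa> z} < ennreal (\<epsilon> / 5)"
      using e5 by (intro order_tendstoD(2)) auto
    \<comment> \<open>The fifth gives strict room for the condition
      \<open>4 * norm (\<theta> - \<theta>0) < \<delta>\<close> of the peeling.\<close>
    have "0 < \<delta> / 5 \<longrightarrow> (\<lambda>N. outer_measure_of (\<Omega> N) {\<omega> \<in> space (\<Omega> N). dist (est N \<omega>) \<theta>0 > \<delta> / 5}) \<longlonglongrightarrow> 0"
      using assms(22) unfolding tendsto_outer_prob_def by (rule spec)
    then have "(\<lambda>N. outer_measure_of (\<Omega> N) {\<omega> \<in> space (\<Omega> N). dist (est N \<omega>) \<theta>0 > \<delta> / 5}) \<longlonglongrightarrow> 0"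
      using \<delta> by simp
    then have ev_est: "\<forall>\<^sub>F N in sequentially. outer_measure_of (\<Omega> N) {\<omega> \<in> space (\<Omega> N). dist (est N \<omega>) \<theta>0 > \<delta> / 5} < ennreal (\<epsilon> / 5)"
      using e5 by (intro order_tendstoD(2)) auto
    have "(\<lambda>N. 8 * real CARD('j) / \<kappa> / sqrt (real N)) \<longlonglongrightarrow> 0"
      by (intro tendsto_divide_0[OF tendsto_const] filterlim_at_top_imp_at_infinity
          filterlim_compose[OF sqrt_at_top filterlim_real_sequentially])
    then have ev_total: "\<forall>\<^sub>F N in sequentially. 8 * real CARD('j) / \<kappa> / sqrt (real N) < \<epsilon> / 5"
      using e5 by (intro order_tendstoD(2)) auto
    have "\<forall>\<^sub>F N in sequentially. outer_measure_of (\<Omega> N)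
        {\<omega> \<in> space (\<Omega> N). \<bar>r N * norm (est N \<omega> - \<theta>0)\<bar> > 2 ^ M} \<le> ennreal \<epsilon>"
      using K ev_sampled ev_est ev_total eventually_ge_at_top[of 1]
    proof eventually_elim
      case (elim N)
      have r: "0 < r N" using assms(19) elim(5) by simp
      obtain E1 where E1: "E1 \<in> sets (\<Omega> N)"
        "emeasure (\<Omega> N) E1 \<le> ennreal (8 * real CARD('j) / \<kappa> / sqrt N)"
        "\<And>z. \<lbrakk>z \<in> space (\<Omega> N) - E1; valid N z; sampled_enough N \<kappa> z\<rbrakk> \<Longrightarrow> real N / 2 \<le> weighted_sum N z (\<lambda>_. 1)"
        unfolding \<Omega>_def using total_weight_event[OF \<kappa> elim(5)] by blast
      have curv': "integrable (distr Q MX fst) (\<lambda>x. m \<theta> x - m \<theta>0 x) \<and>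
           (\<integral>x. (m \<theta> x - m \<theta>0 x) \<partial>distr Q MX fst) \<le> - (K1 * (norm (\<theta> - \<theta>0))\<^sup>2)"
        if "\<theta> \<in> \<Theta>" "norm (\<theta> - \<theta>0) < \<delta>" for \<theta>
        using curv[of \<theta>] that unfolding P0 by (simp add: \<delta>_def)
      have maximal': "outer_expectation (joint_law Q h \<V> n N) (\<lambda>(w, S).
             \<Squnion>\<theta> \<in> {\<theta> \<in> \<Theta>. norm (\<theta> - \<theta>0) < d}.
               ennreal \<bar>emp_process (distr Q MX fst) N w (\<lambda>x. m \<theta> x - m \<theta>0 x)\<bar>) \<le> ennreal (K2 * \<phi> N d)"
        if "0 < d" "d < \<delta>" for d
      proof -
        let ?T = "outer_expectation (joint_law Q h \<V> n N) (\<lambda>(w, S).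
             \<Squnion>\<theta> \<in> {\<theta> \<in> \<Theta>. norm (\<theta> - \<theta>0) < d}.
               ennreal \<bar>emp_process (distr Q MX fst) N w (\<lambda>x. m \<theta> x - m \<theta>0 x)\<bar>)"
        have le: "enn2ereal ?T \<le> ereal (K2 * \<phi> N d)"
          using maximal[of N d] that elim(5) unfolding P0 \<Omega>_def by (simp add: \<delta>_def)
        \<comment> \<open>An outer expectation is nonnegative, which forces its bound to be so as
          well; only then do the \<open>ereal\<close> and \<open>ennreal\<close> bounds
          agree.\<close>
        then have "0 \<le> ereal (K2 * \<phi> N d)" using enn2ereal_nonneg order_trans by blast
        then show ?thesis using le by (simp only: enn2ereal_le_ereal_iff ereal_less_eq(5))
      qed
      obtain E2 where E2: "E2 \<in> sets (\<Omega> N)" "emeasure (\<Omega> N) E2 \<le> ennreal (C * q ^ M)"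
        "\<And>w S \<theta> K. \<lbrakk>(w, S) \<in> space (\<Omega> N) - E2; valid N (w, S); sampled_enough N \<kappa> (w, S);
        real N / 2 \<le> weighted_sum N (w, S) (\<lambda>_. 1); \<theta> \<in> \<Theta>; 4 * norm (\<theta> - \<theta>0) < \<delta>; K \<le> K1 / 4 * 4 ^ M;
        H_emp h \<V> n \<rho> N (w, S) (m \<theta>0) - K / (r N)\<^sup>2 \<le> H_emp h \<V> n \<rho> N (w, S) (m \<theta>)\<rbrakk>
        \<Longrightarrow> r N * norm (\<theta> - \<theta>0) \<le> 2 ^ M"
        unfolding \<Omega>_def C_def q_def
        by (rule peeling_event[OF \<kappa> elim(5) r K1(1) K2(1) curv' maximal' \<open>\<alpha> < 2\<close>
              assms(18)[OF elim(5)] assms(20)[OF elim(5)], where M = M]) blast+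
      let ?B = "{\<omega> \<in> space (\<Omega> N). \<bar>r N * norm (est N \<omega> - \<theta>0)\<bar> > 2 ^ M}"
      let ?Z = "{\<omega> \<in> space (\<Omega> N). \<bar>Z N \<omega>\<bar> > K}"
      let ?T = "{\<omega> \<in> space (\<Omega> N). dist (est N \<omega>) \<theta>0 > \<delta> / 5}"
      let ?S = "{z \<in> space (\<Omega> N). \<not> sampled_enough N \<kappa> z}"
      let ?V = "{z \<in> space (\<Omega> N). \<not> valid N z}"
      have "?B \<subseteq> E1 \<union> (E2 \<union> (?Z \<union> (?T \<union> (?S \<union> ?V))))"
      proof
        fix \<omega> assume B: "\<omega> \<in> ?B"
        show "\<omega> \<in> E1 \<union> (E2 \<union> (?Z \<union> (?T \<union> (?S \<union> ?V))))"
        proof (rule ccontr)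
          assume "\<omega> \<notin> E1 \<union> (E2 \<union> (?Z \<union> (?T \<union> (?S \<union> ?V))))"
          then have *: "\<omega> \<in> space (\<Omega> N) - E1" "\<omega> \<in> space (\<Omega> N) - E2" "\<bar>Z N \<omega>\<bar> \<le> K"
            "dist (est N \<omega>) \<theta>0 \<le> \<delta> / 5" "sampled_enough N \<kappa> \<omega>" "valid N \<omega>"
            using B by auto
          obtain w S where wS: "\<omega> = (w, S)" by (cases \<omega>)
          have "4 * norm (est N \<omega> - \<theta>0) < \<delta>" using *(4) \<delta> by (simp add: dist_norm)
          \<comment> \<open>The slack in the peeling is instantiated by the realized value
            \<open>Z N \<omega>\<close>.\<close>
          moreover have "Z N \<omega> \<le> K1 / 4 * 4 ^ M" using *(3) M(2) by linarith
          ultimately have "r N * norm (est N \<omega> - \<theta>0) \<le> 2 ^ M"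
            using E2(3)[of w S "est N \<omega>" "Z N \<omega>"] * E1(3)[OF *(1,6,5)] assms(21)[of \<omega> N]
              near_max[OF elim(5), of \<omega>] unfolding wS by blast
          then show False using B r by simp
        qed
      qed
      then have "outer_measure_of (\<Omega> N) ?B \<le> outer_measure_of (\<Omega> N) (E1 \<union> (E2 \<union> (?Z \<union> (?T \<union> (?S \<union> ?V)))))"
        by (rule outer_measure_of_mono)
      also have "\<dots> \<le> outer_measure_of (\<Omega> N) E1 + (outer_measure_of (\<Omega> N) E2 + (outer_measure_of (\<Omega> N) ?Z +
          (outer_measure_of (\<Omega> N) ?T + (outer_measure_of (\<Omega> N) ?S + outer_measure_of (\<Omega> N) ?V))))"
        by (intro order_trans[OF outer_measure_of_Un_le] add_left_mono order_refl)
      also have "\<dots> \<le> ennreal (\<epsilon> / 5) + (ennreal (\<epsilon> / 5) + (ennreal (\<epsilon> / 5) + (ennreal (\<epsilon> / 5) + (ennreal (\<epsilon> / 5) + 0))))"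
      proof (intro add_mono)
        show "outer_measure_of (\<Omega> N) E1 \<le> ennreal (\<epsilon> / 5)"
          unfolding outer_measure_of_eq[OF E1(1)]
          by (rule order_trans[OF E1(2) ennreal_leI[OF less_imp_le[OF elim(4)]]])
        show "outer_measure_of (\<Omega> N) E2 \<le> ennreal (\<epsilon> / 5)"
          unfolding outer_measure_of_eq[OF E2(1)]
          by (rule order_trans[OF E2(2) ennreal_leI[OF less_imp_le[OF M(1)]]])
        show "outer_measure_of (\<Omega> N) ?V \<le> 0"
          unfolding \<Omega>_def by (simp add: outer_measure_invalid)
      qed (fact elim(1) less_imp_le[OF elim(3)] less_imp_le[OF elim(2)])+
      also have "\<dots> = ennreal \<epsilon>"
        using \<epsilon> by (simp flip: ennreal_plus)
      finally show ?case .
    qed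
    then show "\<exists>K. \<forall>\<^sub>F N in sequentially. outer_measure_of (\<Omega> N)
        {\<omega> \<in> space (\<Omega> N). \<bar>r N * norm (est N \<omega> - \<theta>0)\<bar> > K} \<le> ennreal \<epsilon>" by blast
  qed
qed

end
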